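(* Let $\mathcal{J}$ be a Euclidean Jordan algebra, let $A=\{a_1,\dots,a_m\}\in\mathcal{J}^m$ and $b\in\mathbb{R}^m$, and let $\mathcal{K}\subseteq\mathcal{J}$ be the convex domain of the feasibility program "find $x\in\mathcal{K}$ with $\langle a_i,x\rangle\le b_i$ for all $i\in[m]$", with width $\rho$. Let $\alpha\in(0,9\rho]$, $\beta\in(0,1)$ and $T=36\alpha^{-2}\rho^2\log m$. Suppose the program is feasible. Then the dense multiplicative weights algorithm described in the context, run with density parameter $s\in\mathbb{N}$ and using an $(\alpha/3,\beta/T)$-approximate, $\rho$-bounded oracle, outputs $x^*\in\mathcal{K}$ such that, with probability at least $1-\beta$, the set $S=\{i\in[m]:\langle a_i,x^*\rangle>b_i+\alpha\}$ satisfies $|S|<s$.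
   Context: A Euclidean Jordan algebra is a finite-dimensional real vector space $\mathcal{J}$ with a commutative bilinear product $\circ$ satisfying $x^2\circ(x\circ y)=x\circ(x^2\circ y)$, an identity element $e$, and an inner product $\langle\cdot,\cdot\rangle$ with $\langle x\circ y,z\rangle=\langle x,y\circ z\rangle$. $\mathcal{K}$ denotes the convex set obtained by intersecting the symmetric cone $\{x\circ x:x\in\mathcal{J}\}$ with a hyperplane $\{x:\langle c,x\rangle=\mathrm{OPT}\}$ ($c\in\mathcal{J}$, $\mathrm{OPT}\in\mathbb{R}$). Width: $\rho$ is a number with $\rho\ge\max_{x\in\mathcal{K}}\max_{i\in[m]}|\langle a_i,x\rangle-b_i|$ (over all admissible instances). An $(\alpha_0,\beta_0)$-approximate, $\rho$-bounded oracle, given a distribution $y\in\mathbb{R}^m$ and $A$, returns with probability at least $1-\beta_0$ a point $x^*\in\mathcal{K}$ with $\langle\sum_iy_ia_i,x^*\rangle\le\min_{x\in\mathcal{K}}\langle\sum_iy_ia_i,x\rangle+\alpha_0$ and $\max_{i}|\langle a_i,x^*\rangle-b_i|\le\rho$. Bregman projection: for a measure $F:[m]\to[0,1]$ with $|F|=\sum_iF_i\le s$, $\Gamma_sF$ is the distribution $(\Gamma_sF)_i=\frac1s\min\{1,cF_i\}$, where $c\ge0$ satisfies $\sum_i\min\{1,cF_i\}=s$. Algorithm: $\eta=\sqrt{(\log m)/T}$; $F^1$ is the uniform distribution on $[m]$. For $t=1,\dots,T$: $\widetilde y^t=\Gamma_sF^t$; $x^t$ is the oracle's answer on $(\widetilde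 y^t,A)$; $\ell^t_i=\frac{1}{2\rho}(b_i-\langle a_i,x^t\rangle)+\frac12$; $F^{t+1}_i=e^{-\eta\ell^t_i}F^t_i$. Output $x^*=\frac1T\sum_{t=1}^Tx^t$. *)

theory Defs
  imports "HOL-Probability.Probability"
begin

text \<open>
  The inner product of the algebra is the one of the type class \<open>euclidean_space\<close>, which also
  provides finite dimension.
\<close>

locale euclidean_jordan_algebra =
  fixes jprod :: "'a::euclidean_space \<Rightarrow> 'a \<Rightarrow> 'a"
    and e :: 'a
  assumes bilinear: "bilinear jprod"
    and commute: "jprod x y = jprod y x"
    and jordan: "jprod (jprod x x) (jprod x y) = jprod x (jprod (jprod x x) y)"
    and unit: "jprod e x = x"
    and assoc_inner: "jprod x y \<bullet> z = x \<bullet> jprod y z"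

definition symmetric_cone :: "('a \<Rightarrow> 'a \<Rightarrow> 'a) \<Rightarrow> 'a set" where
  "symmetric_cone jprod = {jprod x x | x. True}"

definition program_domain :: "('a::euclidean_space \<Rightarrow> 'a \<Rightarrow> 'a) \<Rightarrow> 'a \<Rightarrow> real \<Rightarrow> 'a set" where
  "program_domain jprod c opt = symmetric_cone jprod \<inter> {x. c \<bullet> x = opt}"

definition feasible :: "'a::euclidean_space set \<Rightarrow> 'a ^ 'm \<Rightarrow> real ^ 'm \<Rightarrow> bool" where
  "feasible K a b \<longleftrightarrow> (\<exists>x\<in>K. \<forall>i. a $ i \<bullet> x \<le> b $ i)"

definition width_bound :: "'a::euclidean_space set \<Rightarrow> 'a ^ 'm \<Rightarrow> real ^ 'm \<Rightarrow> real \<Rightarrow> bool" where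
  "width_bound K a b \<rho> \<longleftrightarrow> (\<forall>x\<in>K. \<forall>i. \<bar>a $ i \<bullet> x - b $ i\<bar> \<le> \<rho>)"

definition distribution :: "real ^ 'm::finite \<Rightarrow> bool" where
  "distribution y \<longleftrightarrow> (\<forall>i. 0 \<le> y $ i) \<and> (\<Sum>i\<in>UNIV. y $ i) = 1"

text \<open>
  A randomized oracle for the instance \<open>(K, a, b)\<close> is a Markov kernel from distributions to
  points; every call uses fresh randomness. The infimum stands for the minimum over \<open>K\<close>: it is
  meaningful when \<open>K\<close> is nonempty and its width is bounded, and it equals the minimum whenever
  that is attained. No requirement is made on the returned point outside the success event; in
  particular it need not lie in \<open>K\<close>.
\<close>

definition approx_oracle ::
  "'a::euclidean_space set \<Rightarrow> 'a ^ 'm::finite \<Rightarrow> real ^ 'm \<Rightarrow> real \<Rightarrow> real \<Rightarrow> real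
    \<Rightarrow> (real ^ 'm \<Rightarrow> 'a measure) \<Rightarrow> bool" where
  "approx_oracle K a b \<rho> \<alpha>\<^sub>0 \<beta>\<^sub>0 orac \<longleftrightarrow>
     orac \<in> restrict_space borel {y. distribution y} \<rightarrow>\<^sub>M prob_algebra borel \<and>
     (\<forall>y. distribution y \<longrightarrow>
        \<P>(x in orac y. x \<in> K \<and>
            (\<Sum>i\<in>UNIV. y $ i *\<^sub>R a $ i) \<bullet> x
              \<le> (INF z\<in>K. (\<Sum>i\<in>UNIV. y $ i *\<^sub>R a $ i) \<bullet> z) + \<alpha>\<^sub>0 \<and>
            (\<forall>i. \<bar>a $ i \<bullet> x - b $ i\<bar> \<le> \<rho>))
        \<ge> 1 - \<beta>\<^sub>0)"

text \<open>
  A suitable scaling factor exists for positive \<open>F\<close> and \<open>s \<le> CARD('m)\<close>. It need not be unique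
  (all large factors qualify if \<open>s = CARD('m)\<close>), but the resulting distribution is.
\<close>

definition bregman_projection :: "nat \<Rightarrow> real ^ 'm::finite \<Rightarrow> real ^ 'm" where
  "bregman_projection s F =
     (let c = (SOME c. 0 \<le> c \<and> (\<Sum>i\<in>UNIV. min 1 (c * F $ i)) = real s)
      in \<chi> i. 1 / real s * min 1 (c * F $ i))"

definition loss :: "'a::euclidean_space ^ 'm \<Rightarrow> real ^ 'm \<Rightarrow> real \<Rightarrow> 'a \<Rightarrow> real ^ 'm" where
  "loss a b \<rho> x = (\<chi> i. 1 / (2 * \<rho>) * (b $ i - a $ i \<bullet> x) + 1 / 2)"

text \<open>
  The law of \<open>X\<close> plus the sum of the oracle's answers over \<open>n\<close> further rounds, started from the
  measure \<open>F\<close>.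
\<close>

primrec dense_mw_rounds ::
  "(real ^ 'm::finite \<Rightarrow> 'a::euclidean_space measure) \<Rightarrow> 'a ^ 'm \<Rightarrow> real ^ 'm \<Rightarrow> real \<Rightarrow> nat \<Rightarrow> real
    \<Rightarrow> nat \<Rightarrow> real ^ 'm \<Rightarrow> 'a \<Rightarrow> 'a measure" where
  "dense_mw_rounds orac a b \<rho> s \<eta> 0 F X = return borel X"
| "dense_mw_rounds orac a b \<rho> s \<eta> (Suc n) F X =
     do {
       x \<leftarrow> orac (bregman_projection s F);
       dense_mw_rounds orac a b \<rho> s \<eta> n
         (\<chi> i. exp (- \<eta> * loss a b \<rho> x $ i) * F $ i) (X + x)
     }"

definition dense_mw ::
  "(real ^ 'm::finite \<Rightarrow> 'a::euclidean_space measure) \<Rightarrow> 'a ^ 'm \<Rightarrow> real ^ 'm \<Rightarrow> real \<Rightarrow> nat \<Rightarrow> nat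
    \<Rightarrow> 'a measure" where
  "dense_mw orac a b \<rho> s T =
     do {
       X \<leftarrow> dense_mw_rounds orac a b \<rho> s (sqrt (ln (real CARD('m)) / real T)) T
              (\<chi> i. 1 / real CARD('m)) 0;
       return borel ((1 / real T) *\<^sub>R X)
     }"

end

theory Submission imports Defs begin

text \<open>
  The algorithm is lazy mirror descent with relative entropy on the capped simplex: the
  unprojected weights \<open>F\<close> accumulate all losses, and each round plays the Bregman projection of \<open>F\<close>
  onto the distributions with entries at most \<open>1/s\<close>. The entropy of the projection relative to \<open>F\<close>
  serves as a potential. The Pythagorean inequality for the projection (\<open>bregman_pythagoras\<close>)
  shows that one round with losses in \<open>[0,1]\<close> raises it by at least the step size \<open>\<eta>\<close> times the
  expected loss, up to \<open>\<eta>\<^sup>2/2\<close> (\<open>potential_step\<close>). A correct oracle answer has expected loss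
  at least \<open>1/2 - \<alpha>/(6\<rho>)\<close>, because its objective value is within \<open>\<alpha>/3\<close> of that of a feasible
  point (\<open>oracle_answer_loss\<close>). Hence the potential is large after \<open>T\<close> correct rounds.

  On the other hand, the projection minimises relative entropy, so the potential is at most the
  relative entropy of the uniform distribution on any set \<open>S\<close> of at least \<open>s\<close> indices. If every
  constraint in \<open>S\<close> were violated by the average answer by more than \<open>\<alpha>\<close>, the indices in \<open>S\<close> would
  have had average loss below \<open>1/2 - \<alpha>/(2\<rho>)\<close>, and that relative entropy would be too small
  (\<open>few_violated_constraints\<close>). The choice of \<open>T\<close> makes \<open>\<eta> \<le> \<alpha>/(6\<rho>)\<close>, which leaves room for the
  error terms.

  The average of the answers must also lie in \<open>K\<close>, so the cone of squares has to be convex. This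
  follows from its self-duality (\<open>symmetric_cone_self_dual\<close>), which rests on the spectral theorem
  of the algebra: every element is a linear combination of orthogonal idempotents
  (\<open>spectral_decomposition\<close>), and multiplication by an idempotent is positive semidefinite.
  Closedness of the cone, read off from the same description, provides measurability of \<open>K\<close>.

  On the probabilistic side, all facts about correct rounds are collected in an invariant of the
  state of the algorithm, and the union bound over the rounds is an induction along the iterated
  kernel (\<open>dense_mw_rounds_invariant\<close>).
\<close>

section \<open>Spectral theory of self-adjoint maps\<close>

text \<open>
  A maximiser of the quadratic form \<open>x \<bullet> f x\<close> over the unit sphere of \<open>W\<close> is an eigenvector: this is
  the first-order condition.
\<close>

lemma selfadjoint_eigenvector:
  fixes f :: "'a::euclidean_space \<Rightarrow> 'a"
  assumes lin: "linear f" and sa: "\<And>x y. f x \<bullet> y = x \<bullet> f y"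
    and W: "subspace W" "f ` W \<subseteq> W" "W \<noteq> {0}"
  obtains x \<mu> where "x \<in> W" "x \<noteq> 0" "f x = \<mu> *\<^sub>R x"
proof -
  interpret f: linear f by (rule lin)
  have cont: "continuous_on UNIV f"
    using lin by (simp add: linear_continuous_on linear_conv_bounded_linear)
  define S where "S = W \<inter> sphere 0 1"
  have "compact S"
    unfolding S_def using W(1) by (intro closed_Int_compact closed_subspace) auto
  moreover have "S \<noteq> {}"
  proof -
    obtain w where "w \<in> W" "w \<noteq> 0" using W(1,3) subspace_0 by blast
    then have "(1 / norm w) *\<^sub>R w \<in> S"
      using W(1) by (auto simp: S_def intro: subspace_scale)
    then show ?thesis by blast
  qed
  moreover have "continuous_on S (\<lambda>x. x \<bullet> f x)"
    by (rule continuous_on_inner[OF continuous_on_id continuous_on_subset[OF cont subset_UNIV]])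
  ultimately obtain x where x: "x \<in> S" "\<And>y. y \<in> S \<Longrightarrow> y \<bullet> f y \<le> x \<bullet> f x"
    using continuous_attains_sup[of S "\<lambda>x. x \<bullet> f x"] by blast
  define \<mu> where "\<mu> = x \<bullet> f x"
  have xW: "x \<in> W" and xx: "x \<bullet> x = 1"
    using x(1) by (auto simp: S_def dot_square_norm)
  have form: "z \<bullet> f z \<le> \<mu> * (z \<bullet> z)" if "z \<in> W" for z
  proof (cases "z = 0")
    case False
    have "(1 / norm z) *\<^sub>R z \<in> S"
      using W(1) that False by (auto simp: S_def intro: subspace_scale)
    from x(2)[OF this] have "(1 / norm z)\<^sup>2 * (z \<bullet> f z) \<le> \<mu>"
      by (simp add: \<mu>_def f.scaleR power2_eq_square)
    then show ?thesis using False
      by (simp add: power_divide divide_le_eq dot_square_norm)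
  qed (simp add: f.zero)
  define d where "d = f x - \<mu> *\<^sub>R x"
  have dW: "d \<in> W"
    using W xW by (auto simp: d_def intro!: subspace_diff subspace_scale)
  define C where "C = \<mu> * (d \<bullet> d) - d \<bullet> f d"
  have C0: "0 \<le> C" using form[OF dW] by (simp add: C_def)
  have fx: "f x = d + \<mu> *\<^sub>R x" by (simp add: d_def)
  have xd: "x \<bullet> f d = d \<bullet> d + \<mu> * (x \<bullet> d)"
    unfolding sa[symmetric] fx by (simp add: inner_add_left)
  have xd0: "x \<bullet> d = 0"
    by (simp add: d_def inner_diff_right \<mu>_def xx)
  \<comment> \<open>The residual \<open>d\<close> is the ascent direction of the form at \<open>x\<close>; a step along it stays in \<open>W\<close>.\<close>
  have ineq: "0 \<le> t\<^sup>2 * C - 2 * t * (d \<bullet> d)" for t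
  proof -
    have "x + t *\<^sub>R d \<in> W" using W(1) xW dW by (intro subspace_add subspace_scale)
    from form[OF this] show ?thesis
      unfolding f.add f.scaleR fx
      by (simp add: inner_add_left inner_add_right xx xd xd0 inner_commute[of d x] C_def
          power2_eq_square algebra_simps)
  qed
  have "d \<bullet> d = 0"
  proof (rule ccontr)
    assume "d \<bullet> d \<noteq> 0"
    then have D: "0 < d \<bullet> d" by simp
    define t where "t = d \<bullet> d / (C + 1)"
    have "d \<bullet> d = t * (C + 1)" using C0 by (simp add: t_def)
    then have "t\<^sup>2 * C - 2 * t * (d \<bullet> d) = - (t\<^sup>2 * (C + 2))"
      by (simp add: power2_eq_square algebra_simps)
    moreover have "0 < t\<^sup>2 * (C + 2)" using D C0 by (simp add: t_def)
    ultimately show False using ineq[of t] by linarith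
  qed
  then have "f x = \<mu> *\<^sub>R x" by (simp add: d_def)
  moreover have "x \<noteq> 0" using xx by auto
  ultimately show thesis using that xW by blast
qed

text \<open>
  The orthogonal complement of all eigenvectors is invariant. If it were nonzero, it would contain
  an eigenvector.
\<close>

lemma span_eigenvectors_selfadjoint:
  fixes f :: "'a::euclidean_space \<Rightarrow> 'a"
  assumes lin: "linear f" and sa: "\<And>x y. f x \<bullet> y = x \<bullet> f y"
  shows "span {v. \<exists>\<mu>. f v = \<mu> *\<^sub>R v} = UNIV"
proof -
  interpret f: linear f by (rule lin)
  define E where "E = {v. \<exists>\<mu>. f v = \<mu> *\<^sub>R v}"
  define W where "W = {w. \<forall>u\<in>span E. w \<bullet> u = 0}"
  have inv: "f u \<in> span E" if "u \<in> span E" for u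
    using that
  proof (induction rule: span_induct_alt)
    case base
    then show ?case by (simp add: f.zero span_zero)
  next
    case (step c x y)
    then obtain \<mu> where "f x = \<mu> *\<^sub>R x" by (auto simp: E_def)
    moreover have "x \<in> span E" using step(1) by (rule span_base)
    ultimately have "f x \<in> span E" by (simp add: span_scale)
    then show ?case using step by (auto simp: f.add f.scaleR intro!: span_add span_scale)
  qed
  have "subspace W" by (auto simp: W_def subspace_def inner_add_left)
  moreover have "f ` W \<subseteq> W" using inv by (auto simp: W_def sa)
  moreover have False if "x \<in> W" "x \<noteq> 0" "f x = \<mu> *\<^sub>R x" for x \<mu>
  proof -
    have "x \<in> span E" using that(3) by (auto simp: E_def intro: span_base)
    then show False using that(1,2) by (auto simp: W_def)
  qed
  ultimately have "W = {0}"
    using selfadjoint_eigenvector[OF lin sa, of W] by blast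
  have "x \<in> span E" for x
  proof -
    obtain y z where "y \<in> span E" "\<And>w. w \<in> span E \<Longrightarrow> orthogonal z w" and x: "x = y + z"
      using orthogonal_subspace_decomp_exists[of E x] by blast
    moreover from this have "z \<in> W" by (simp add: W_def orthogonal_def)
    ultimately show ?thesis using \<open>W = {0}\<close> by simp
  qed
  then show ?thesis by (auto simp: E_def)
qed

text \<open>
  The summands are indexed by their eigenvalues, so that distinct summands belong to distinct
  eigenvalues and can be separated by polynomials in \<open>f\<close>.
\<close>

lemma eigenvector_decomposition:
  fixes f :: "'a::euclidean_space \<Rightarrow> 'a"
  assumes lin: "linear f" and sa: "\<And>x y. f x \<bullet> y = x \<bullet> f y"
  obtains \<Lambda> v where "finite \<Lambda>" "\<And>\<mu>. \<mu> \<in> \<Lambda> \<Longrightarrow> f (v \<mu>) = \<mu> *\<^sub>R v \<mu>" "x = sum v \<Lambda>"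
proof -
  interpret f: linear f by (rule lin)
  have "x \<in> span {v. \<exists>\<mu>. f v = \<mu> *\<^sub>R v}"
    using span_eigenvectors_selfadjoint[OF lin sa] by blast
  then have "\<exists>\<Lambda> v. finite \<Lambda> \<and> (\<forall>\<mu>\<in>\<Lambda>. f (v \<mu>) = \<mu> *\<^sub>R v \<mu>) \<and> x = sum v \<Lambda>"
  proof (induction rule: span_induct_alt)
    case base
    then show ?case by (intro exI[of _ "{}"]) auto
  next
    case (step c u y)
    from step(1) obtain \<mu> where \<mu>: "f u = \<mu> *\<^sub>R u" by blast
    from step(2) obtain \<Lambda> v where IH: "finite \<Lambda>" "\<forall>\<mu>\<in>\<Lambda>. f (v \<mu>) = \<mu> *\<^sub>R v \<mu>" "y = sum v \<Lambda>"
      by blast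
    define v' where "v' = (\<lambda>k. (if k = \<mu> then c *\<^sub>R u else 0) + (if k \<in> \<Lambda> then v k else 0))"
    have "sum v' (insert \<mu> \<Lambda>) = c *\<^sub>R u + y"
      using IH(1) unfolding v'_def sum.distrib IH(3)
      by (subst sum.mono_neutral_right[of "insert \<mu> \<Lambda>" \<Lambda> "\<lambda>k. if k \<in> \<Lambda> then v k else 0"])
         (auto simp: sum.delta)
    moreover have "\<forall>k\<in>insert \<mu> \<Lambda>. f (v' k) = k *\<^sub>R v' k"
      using IH(2) \<mu> by (auto simp: v'_def f.add f.scaleR f.zero scaleR_add_right)
    ultimately show ?case using IH(1) by (intro exI[of _ "insert \<mu> \<Lambda>"] exI[of _ v']) auto
  qed
  then obtain \<Lambda> v where "finite \<Lambda>" "\<forall>\<mu>\<in>\<Lambda>. f (v \<mu>) = \<mu> *\<^sub>R v \<mu>" "x = sum v \<Lambda>"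
    by (elim exE conjE)
  then show thesis by (intro that[of \<Lambda> v]) simp_all
qed

lemma eigenvector_summands_in_invariant_subspace:
  fixes f :: "'a::real_vector \<Rightarrow> 'a"
  assumes lin: "linear f" and A: "subspace A" "f ` A \<subseteq> A"
  shows "\<lbrakk>finite \<Lambda>; \<forall>\<mu>\<in>\<Lambda>. f (v \<mu>) = \<mu> *\<^sub>R v \<mu>; sum v \<Lambda> \<in> A; \<mu> \<in> \<Lambda>\<rbrakk> \<Longrightarrow> v \<mu> \<in> A"
proof (induction \<Lambda> arbitrary: v \<mu> rule: finite_induct)
  case (insert k \<Lambda>)
  interpret f: linear f by (rule lin)
  \<comment> \<open>Applying \<open>f - k\<close> removes the summand for \<open>k\<close> and only rescales the others.\<close>
  let ?w = "\<lambda>\<mu>. (\<mu> - k) *\<^sub>R v \<mu>"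
  have "f (sum v (insert k \<Lambda>)) = (\<Sum>\<mu>\<in>insert k \<Lambda>. \<mu> *\<^sub>R v \<mu>)"
    unfolding f.sum using insert.prems(1) by (intro sum.cong) auto
  then have "sum ?w \<Lambda> = f (sum v (insert k \<Lambda>)) - k *\<^sub>R sum v (insert k \<Lambda>)"
    using insert.hyps
    by (simp add: scaleR_left_diff_distrib sum_subtractf scaleR_sum_right scaleR_add_right)
  then have "sum ?w \<Lambda> \<in> A"
    using A insert.prems(2) by (auto intro!: subspace_diff subspace_scale)
  moreover have "\<forall>\<mu>\<in>\<Lambda>. f (?w \<mu>) = \<mu> *\<^sub>R ?w \<mu>"
    using insert.prems(1) by (simp add: f.scaleR)
  ultimately have "?w \<mu> \<in> A" if "\<mu> \<in> \<Lambda>" for \<mu>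
    using insert.IH[of ?w \<mu>] that by blast
  then have *: "v \<mu> \<in> A" if "\<mu> \<in> \<Lambda>" for \<mu>
    using that subspace_scale[OF A(1), of "?w \<mu>" "1 / (\<mu> - k)"] insert.hyps(2) by (cases "\<mu> = k") auto
  have "v k = sum v (insert k \<Lambda>) - sum v \<Lambda>" using insert.hyps by simp
  also have "\<dots> \<in> A" using insert.prems(2) * subspace_sum[OF A(1), of \<Lambda> v]
    by (intro subspace_diff A(1)) auto
  finally show ?case using * insert.prems(3) by blast
qed simp

section \<open>The cone of squares of a Euclidean Jordan algebra\<close>

context euclidean_jordan_algebra
begin

notation jprod (infixl "\<odot>" 70)

lemma jprod_add [simp]: "(x + y) \<odot> z = x \<odot> z + y \<odot> z" "x \<odot> (y + z) = x \<odot> y + x \<odot> z"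
  using bilinear by (simp_all add: bilinear_ladd bilinear_radd)

lemma jprod_diff [simp]: "(x - y) \<odot> z = x \<odot> z - y \<odot> z" "x \<odot> (y - z) = x \<odot> y - x \<odot> z"
  using bilinear by (simp_all add: bilinear_lsub bilinear_rsub)

lemma jprod_scaleR [simp]: "(r *\<^sub>R x) \<odot> y = r *\<^sub>R (x \<odot> y)" "x \<odot> (r *\<^sub>R y) = r *\<^sub>R (x \<odot> y)"
  using bilinear by (simp_all add: bilinear_lmul bilinear_rmul)

lemma jprod_zero [simp]: "0 \<odot> x = 0" "x \<odot> 0 = 0"
  using bilinear by (simp_all add: bilinear_lzero bilinear_rzero)

lemma jprod_sum: "sum v I \<odot> y = (\<Sum>i\<in>I. v i \<odot> y)" "y \<odot> sum v I = (\<Sum>i\<in>I. y \<odot> v i)"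
  by (induction I rule: infinite_finite_induct) auto

lemma linear_jprod: "linear (jprod x)"
  using bilinear by (simp add: bilinear_def)

lemma jprod_unit [simp]: "e \<odot> x = x" "x \<odot> e = x"
  using unit commute by metis+

lemma jprod_selfadjoint: "(x \<odot> y) \<bullet> z = y \<bullet> (x \<odot> z)"
  using assoc_inner commute by metis

text \<open>
  The derivative of the Jordan identity with respect to \<open>x\<close> in direction \<open>z\<close>. Since the identity is
  cubic in \<open>x\<close>, a symmetric difference isolates this derivative up to the identity for \<open>z\<close> itself.
\<close>

lemma jordan_half_linearized:
  "2 *\<^sub>R ((x \<odot> z) \<odot> (x \<odot> y)) + (x \<odot> x) \<odot> (z \<odot> y) = 2 *\<^sub>R (x \<odot> ((x \<odot> z) \<odot> y)) + z \<odot> ((x \<odot> x) \<odot> y)"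
proof -
  define D where "D u = (u \<odot> u) \<odot> (u \<odot> y) - u \<odot> ((u \<odot> u) \<odot> y)" for u
  have D: "D u = 0" for u by (simp add: D_def jordan)
  have "D (x + z) - D (x - z) - 2 *\<^sub>R D z
    = 2 *\<^sub>R (2 *\<^sub>R ((x \<odot> z) \<odot> (x \<odot> y)) + (x \<odot> x) \<odot> (z \<odot> y) - (2 *\<^sub>R (x \<odot> ((x \<odot> z) \<odot> y)) + z \<odot> ((x \<odot> x) \<odot> y)))"
    unfolding D_def by (simp add: commute[of z x] scaleR_2 algebra_simps)
  then show ?thesis by (simp add: D)
qed

lemma jordan_linearized:
  "(x \<odot> z) \<odot> (w \<odot> y) + (w \<odot> z) \<odot> (x \<odot> y) + (x \<odot> w) \<odot> (z \<odot> y)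
    = w \<odot> ((x \<odot> z) \<odot> y) + x \<odot> ((w \<odot> z) \<odot> y) + z \<odot> ((x \<odot> w) \<odot> y)"
proof -
  define D where "D u = 2 *\<^sub>R ((u \<odot> z) \<odot> (u \<odot> y)) + (u \<odot> u) \<odot> (z \<odot> y)
    - (2 *\<^sub>R (u \<odot> ((u \<odot> z) \<odot> y)) + z \<odot> ((u \<odot> u) \<odot> y))" for u
  have D: "D u = 0" for u by (simp add: D_def jordan_half_linearized)
  have "D (x + w) - D x - D w = 2 *\<^sub>R (
    (x \<odot> z) \<odot> (w \<odot> y) + (w \<odot> z) \<odot> (x \<odot> y) + (x \<odot> w) \<odot> (z \<odot> y)
    - (w \<odot> ((x \<odot> z) \<odot> y) + x \<odot> ((w \<odot> z) \<odot> y) + z \<odot> ((x \<odot> w) \<odot> y)))"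
    unfolding D_def by (simp add: commute[of w x] scaleR_2 algebra_simps)
  then show ?thesis by (simp add: D)
qed

text \<open>
  Read as an identity between operators applied to \<open>z\<close>, this expresses multiplication by a triple
  product through multiplications by products of at most two factors.
\<close>

lemma mult_operator_triple:
  "((x \<odot> w) \<odot> y) \<odot> z = (w \<odot> y) \<odot> (x \<odot> z) + (x \<odot> y) \<odot> (w \<odot> z) + (x \<odot> w) \<odot> (y \<odot> z)
     - w \<odot> (y \<odot> (x \<odot> z)) - x \<odot> (y \<odot> (w \<odot> z))"
proof -
  have "(x \<odot> z) \<odot> (w \<odot> y) = (w \<odot> y) \<odot> (x \<odot> z)" "(w \<odot> z) \<odot> (x \<odot> y) = (x \<odot> y) \<odot> (w \<odot> z)"
    "z \<odot> y = y \<odot> z" "(x \<odot> z) \<odot> y = y \<odot> (x \<odot> z)" "(w \<odot> z) \<odot> y = y \<odot> (w \<odot> z)"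
    "z \<odot> ((x \<odot> w) \<odot> y) = ((x \<odot> w) \<odot> y) \<odot> z"
    by (rule commute)+
  then show ?thesis using jordan_linearized[of x z w y] by (simp add: algebra_simps)
qed

primrec jpow :: "'a \<Rightarrow> nat \<Rightarrow> 'a" where
  "jpow x 0 = e"
| "jpow x (Suc n) = jpow x n \<odot> x"

text \<open>
  By \<open>mult_operator_triple\<close>, multiplication by \<open>jpow x n\<close> is a polynomial in the multiplications by
  \<open>x\<close> and \<open>x \<odot> x\<close>, which commute by the Jordan identity. Commuting with \<open>x \<odot> x\<close> is carried along
  because the recursion contains that operator as well.
\<close>

lemma jpow_operator_commute:
  "jpow x n \<odot> (x \<odot> z) = x \<odot> (jpow x n \<odot> z) \<and>
   jpow x n \<odot> ((x \<odot> x) \<odot> z) = (x \<odot> x) \<odot> (jpow x n \<odot> z)"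
proof (induction n arbitrary: z rule: less_induct)
  case (less n)
  consider "n = 0" | "n = 1" | k where "n = Suc (Suc k)"
    by (metis One_nat_def not0_implies_Suc)
  then show ?case
  proof cases
    case 3
    define p q where "p = jpow x k" "q = jpow x (Suc k)"
    have p: "p \<odot> (x \<odot> z) = x \<odot> (p \<odot> z)" "p \<odot> ((x \<odot> x) \<odot> z) = (x \<odot> x) \<odot> (p \<odot> z)" for z
      using less[of k] 3 by (auto simp: p_q_def)
    have q: "q \<odot> (x \<odot> z) = x \<odot> (q \<odot> z)" "q \<odot> ((x \<odot> x) \<odot> z) = (x \<odot> x) \<odot> (q \<odot> z)" for z
      using less[of "Suc k"] 3 by (auto simp: p_q_def simp del: jpow.simps)
    have s: "(x \<odot> x) \<odot> (x \<odot> z) = x \<odot> ((x \<odot> x) \<odot> z)" for z by (rule jordan)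
    have qp: "q = p \<odot> x" "jpow x n = q \<odot> x" by (simp_all add: 3 p_q_def)
    have *: "jpow x n \<odot> z = x \<odot> (q \<odot> z) + x \<odot> (q \<odot> z) + (x \<odot> x) \<odot> (p \<odot> z) - x \<odot> (x \<odot> (p \<odot> z)) - x \<odot> (x \<odot> (p \<odot> z))" for z
      using mult_operator_triple[of p x x z] by (simp add: qp[symmetric] p q algebra_simps)
    show ?thesis by (simp add: * p q s)
  qed (auto simp: jordan)
qed

text \<open>
  The Peirce identity: multiplication by an idempotent has no eigenvalues besides \<open>0\<close>, \<open>1/2\<close>, \<open>1\<close>.
\<close>

lemma idempotent_operator_cubic:
  assumes "c \<odot> c = c"
  shows "2 *\<^sub>R (c \<odot> (c \<odot> (c \<odot> z))) = 3 *\<^sub>R (c \<odot> (c \<odot> z)) - c \<odot> z"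
proof -
  have "(3::real) *\<^sub>R u = u + u + u" for u :: 'a
    using scaleR_add_left[of 2 1 u] by (simp add: scaleR_2)
  then show ?thesis
  using mult_operator_triple[of c c c z] assms by (simp add: algebra_simps scaleR_2)
qed

text \<open>
  Let \<open>L\<close> be multiplication by \<open>c\<close>. The polynomials \<open>P = 2 L\<^sup>2 - L\<close> and \<open>Q = 4 (L - L\<^sup>2)\<close> take the
  values \<open>0, 0, 1\<close> and \<open>0, 1, 0\<close> at the possible eigenvalues \<open>0, 1/2, 1\<close>, so they are the spectral
  projections and \<open>L = P\<^sup>2 + Q\<^sup>2 / 2\<close>.
\<close>

lemma idempotent_operator_psd:
  assumes "c \<odot> c = c"
  shows "0 \<le> c \<bullet> (z \<odot> z)"
proof -
  define u w where "u = c \<odot> z" "w = c \<odot> (c \<odot> z)"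
  have cw: "2 *\<^sub>R (c \<odot> w) = 3 *\<^sub>R w - u"
    using idempotent_operator_cubic[OF assms, of z] by (simp add: u_w_def)
  have zw: "z \<bullet> w = u \<bullet> u"
    by (simp add: u_w_def jprod_selfadjoint)
  have "2 * (w \<bullet> u) = z \<bullet> (2 *\<^sub>R (c \<odot> w))"
    by (simp add: u_w_def jprod_selfadjoint)
  then have wu: "2 * (w \<bullet> u) = 3 * (u \<bullet> u) - z \<bullet> u"
    unfolding cw by (simp add: inner_diff_right zw)
  have "2 * (w \<bullet> w) = u \<bullet> (2 *\<^sub>R (c \<odot> w))"
    by (simp add: u_w_def jprod_selfadjoint)
  then have ww: "2 * (w \<bullet> w) = 3 * (w \<bullet> u) - u \<bullet> u"
    unfolding cw by (simp add: inner_diff_right inner_commute)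
  have "c \<bullet> (z \<odot> z) = z \<bullet> u"
    unfolding u_w_def by (metis assoc_inner inner_commute)
  also have "\<dots> = (2 *\<^sub>R w - u) \<bullet> (2 *\<^sub>R w - u) + 8 * ((u - w) \<bullet> (u - w))"
    using wu ww by (simp add: inner_diff_left inner_diff_right inner_commute[of u w])
  also have "\<dots> \<ge> 0" by simp
  finally show ?thesis .
qed

text \<open>
  Decompose the unit into eigenvectors of multiplication by \<open>x\<close>. Each summand lies in the span of
  the powers of \<open>x\<close>, so multiplication by it commutes with multiplication by \<open>x\<close>. Hence the product
  of two summands is an eigenvector for both eigenvalues and vanishes if these differ; multiplying
  \<open>e = sum v \<Lambda>\<close> by a summand then shows that the summand is idempotent.
\<close>

lemma spectral_decomposition:
  obtains \<Lambda> v where "finite \<Lambda>" "e = sum v \<Lambda>" "\<And>\<mu>. \<mu> \<in> \<Lambda> \<Longrightarrow> x \<odot> v \<mu> = \<mu> *\<^sub>R v \<mu>"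
    "\<And>\<mu>. \<mu> \<in> \<Lambda> \<Longrightarrow> v \<mu> \<odot> v \<mu> = v \<mu>"
    "\<And>\<mu> \<nu>. \<lbrakk>\<mu> \<in> \<Lambda>; \<nu> \<in> \<Lambda>; \<mu> \<noteq> \<nu>\<rbrakk> \<Longrightarrow> v \<mu> \<odot> v \<nu> = 0"
proof -
  obtain \<Lambda> v where v: "finite \<Lambda>" "\<And>\<mu>. \<mu> \<in> \<Lambda> \<Longrightarrow> x \<odot> v \<mu> = \<mu> *\<^sub>R v \<mu>" "e = sum v \<Lambda>"
    using eigenvector_decomposition[OF linear_jprod jprod_selfadjoint] by blast
  define A where "A = span (range (jpow x))"
  have inv: "x \<odot> u \<in> A" if "u \<in> A" for u
    using that unfolding A_def
  proof (induction rule: span_induct_alt)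
    case (step c u y)
    then obtain n where "u = jpow x n" by blast
    then have "x \<odot> u = jpow x (Suc n)" by (simp add: commute)
    then have "x \<odot> u \<in> span (range (jpow x))" by (metis rangeI span_base)
    then show ?case using step by (auto intro!: span_add span_scale)
  qed (simp add: span_zero)
  have com: "x \<odot> (u \<odot> y) = u \<odot> (x \<odot> y)" if "u \<in> A" for u y
    using that unfolding A_def
    by (induction rule: span_induct_alt) (auto simp: jpow_operator_commute)
  have "e \<in> A" unfolding A_def by (metis jpow.simps(1) rangeI span_base)
  then have vA: "v \<mu> \<in> A" if "\<mu> \<in> \<Lambda>" for \<mu>
    using eigenvector_summands_in_invariant_subspace[OF linear_jprod, of A x \<Lambda> v \<mu>] that inv v
    by (auto simp: A_def subspace_span)
  have orth: "v \<mu> \<odot> v \<nu> = 0" if "\<mu> \<in> \<Lambda>" "\<nu> \<in> \<Lambda>" "\<mu> \<noteq> \<nu>" for \<mu> \<nu>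
  proof -
    \<comment> \<open>The product is an eigenvector for both eigenvalues.\<close>
    have "x \<odot> (v \<mu> \<odot> v \<nu>) = \<nu> *\<^sub>R (v \<mu> \<odot> v \<nu>)"
      using com[OF vA[OF that(1)]] v(2)[OF that(2)] by simp
    moreover have "x \<odot> (v \<mu> \<odot> v \<nu>) = \<mu> *\<^sub>R (v \<mu> \<odot> v \<nu>)"
      using com[OF vA[OF that(2)]] v(2)[OF that(1)] by (simp add: commute[of "v \<mu>"])
    ultimately have "\<nu> *\<^sub>R (v \<mu> \<odot> v \<nu>) = \<mu> *\<^sub>R (v \<mu> \<odot> v \<nu>)" by metis
    then show ?thesis using that(3) by simp
  qed
  have "v \<mu> \<odot> v \<mu> = v \<mu>" if "\<mu> \<in> \<Lambda>" for \<mu>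
  proof -
    have "v \<mu> = v \<mu> \<odot> sum v \<Lambda>" by (simp flip: v(3))
    also have "\<dots> = (\<Sum>\<nu>\<in>\<Lambda>. if \<nu> = \<mu> then v \<mu> \<odot> v \<mu> else 0)"
      unfolding jprod_sum using orth[OF that] by (intro sum.cong) auto
    finally show ?thesis using that v(1) by (simp add: sum.delta)
  qed
  then show thesis using that[OF v(1) v(3) v(2)] orth by blast
qed

text \<open>
  In a spectral decomposition, a square has coefficients \<open>\<mu>\<^sup>2\<close>, and idempotents are positive against
  squares. Conversely, testing an element against its own idempotents shows that its eigenvalues
  are nonnegative, so it has a square root.
\<close>

theorem symmetric_cone_self_dual:
  "symmetric_cone jprod = {x. \<forall>z. 0 \<le> x \<bullet> (z \<odot> z)}"
proof (intro equalityI subsetI)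
  fix w assume "w \<in> symmetric_cone jprod"
  then obtain x where w: "w = x \<odot> x" by (auto simp: symmetric_cone_def)
  obtain \<Lambda> v where v: "finite \<Lambda>" "e = sum v \<Lambda>" "\<And>\<mu>. \<mu> \<in> \<Lambda> \<Longrightarrow> x \<odot> v \<mu> = \<mu> *\<^sub>R v \<mu>"
    "\<And>\<mu>. \<mu> \<in> \<Lambda> \<Longrightarrow> v \<mu> \<odot> v \<mu> = v \<mu>"
    "\<And>\<mu> \<nu>. \<lbrakk>\<mu> \<in> \<Lambda>; \<nu> \<in> \<Lambda>; \<mu> \<noteq> \<nu>\<rbrakk> \<Longrightarrow> v \<mu> \<odot> v \<nu> = 0"
    using spectral_decomposition[of x] by metis
  have "w = x \<odot> (x \<odot> sum v \<Lambda>)" by (simp add: w flip: v(2))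
  also have "\<dots> = (\<Sum>\<mu>\<in>\<Lambda>. \<mu>\<^sup>2 *\<^sub>R v \<mu>)"
    unfolding jprod_sum by (intro sum.cong) (auto simp: v(3) power2_eq_square)
  finally have "w \<bullet> (z \<odot> z) = (\<Sum>\<mu>\<in>\<Lambda>. \<mu>\<^sup>2 * (v \<mu> \<bullet> (z \<odot> z)))" for z
    by (simp add: inner_sum_left)
  then show "w \<in> {x. \<forall>z. 0 \<le> x \<bullet> (z \<odot> z)}"
    using idempotent_operator_psd v(4) by (auto intro!: sum_nonneg mult_nonneg_nonneg)
next
  fix w assume "w \<in> {x. \<forall>z. 0 \<le> x \<bullet> (z \<odot> z)}"
  then have psd: "0 \<le> w \<bullet> (z \<odot> z)" for z by blast
  obtain \<Lambda> v where v: "finite \<Lambda>" "e = sum v \<Lambda>" "\<And>\<mu>. \<mu> \<in> \<Lambda> \<Longrightarrow> w \<odot> v \<mu> = \<mu> *\<^sub>R v \<mu>"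
    "\<And>\<mu>. \<mu> \<in> \<Lambda> \<Longrightarrow> v \<mu> \<odot> v \<mu> = v \<mu>"
    "\<And>\<mu> \<nu>. \<lbrakk>\<mu> \<in> \<Lambda>; \<nu> \<in> \<Lambda>; \<mu> \<noteq> \<nu>\<rbrakk> \<Longrightarrow> v \<mu> \<odot> v \<nu> = 0"
    using spectral_decomposition[of w] by metis
  have nonneg: "0 \<le> \<mu> \<or> v \<mu> = 0" if "\<mu> \<in> \<Lambda>" for \<mu>
  proof -
    have "w \<bullet> (v \<mu> \<odot> v \<mu>) = \<mu> * (v \<mu> \<bullet> v \<mu>)"
      using v(3)[OF that] by (simp flip: assoc_inner)
    then have "0 \<le> \<mu> * (v \<mu> \<bullet> v \<mu>)" using psd[of "v \<mu>"] by simp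
    then show ?thesis by (meson inner_gt_zero_iff mult_neg_pos not_le)
  qed
  \<comment> \<open>A square root of a negative number occurs only in front of \<open>v \<mu> = 0\<close>.\<close>
  define r where "r = (\<Sum>\<mu>\<in>\<Lambda>. sqrt \<mu> *\<^sub>R v \<mu>)"
  have "r \<odot> r = (\<Sum>\<mu>\<in>\<Lambda>. \<Sum>\<nu>\<in>\<Lambda>. if \<nu> = \<mu> then \<mu> *\<^sub>R v \<mu> else 0)"
    unfolding r_def jprod_sum(1) unfolding jprod_sum(2)
  proof (intro sum.cong refl)
    fix \<mu> \<nu> assume "\<mu> \<in> \<Lambda>" "\<nu> \<in> \<Lambda>"
    then show "sqrt \<mu> *\<^sub>R v \<mu> \<odot> sqrt \<nu> *\<^sub>R v \<nu> = (if \<nu> = \<mu> then \<mu> *\<^sub>R v \<mu> else 0)"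
      using nonneg[of \<mu>] v(4,5) by auto
  qed
  also have "\<dots> = (\<Sum>\<mu>\<in>\<Lambda>. \<mu> *\<^sub>R v \<mu>)" using v(1) by (simp add: sum.delta)
  also have "\<dots> = w \<odot> sum v \<Lambda>" unfolding jprod_sum by (intro sum.cong) (auto simp: v(3))
  finally have "w = r \<odot> r" by (simp flip: v(2))
  then show "w \<in> symmetric_cone jprod" by (auto simp: symmetric_cone_def)
qed

lemma closed_symmetric_cone: "closed (symmetric_cone jprod)"
proof -
  have "{x. \<forall>z. 0 \<le> x \<bullet> (z \<odot> z)} = (\<Inter>z. {x. 0 \<le> x \<bullet> (z \<odot> z)})" by auto
  then show ?thesis
    unfolding symmetric_cone_self_dual by (auto intro!: closed_Collect_le continuous_intros)
qed

lemma symmetric_cone_add: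
  "\<lbrakk>x \<in> symmetric_cone jprod; y \<in> symmetric_cone jprod\<rbrakk> \<Longrightarrow> x + y \<in> symmetric_cone jprod"
  unfolding symmetric_cone_self_dual by (auto simp: inner_add_left)

lemma symmetric_cone_scaleR:
  "\<lbrakk>x \<in> symmetric_cone jprod; 0 \<le> r\<rbrakk> \<Longrightarrow> r *\<^sub>R x \<in> symmetric_cone jprod"
  unfolding symmetric_cone_self_dual by auto

lemma zero_in_symmetric_cone: "0 \<in> symmetric_cone jprod"
  unfolding symmetric_cone_self_dual by auto

end

section \<open>Relative entropy and the Bregman projection\<close>

text \<open>
  The second argument is not normalised: it is compared with the accumulated weights of the
  algorithm, whose total mass changes from round to round.
\<close>

definition relative_entropy :: "real ^ 'm::finite \<Rightarrow> real ^ 'm \<Rightarrow> real" where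
  "relative_entropy q F = (\<Sum>i\<in>UNIV. q $ i * ln (q $ i / F $ i))"

text \<open>
  Gibbs' inequality. In this form \<open>r\<close> can be any positive measure, which spares the normalisation
  of the reweighted distribution in \<open>potential_step\<close>.
\<close>

lemma relative_entropy_ge:
  assumes q: "\<And>i. 0 \<le> q $ i" and r: "\<And>i. 0 < r $ i"
  shows "(\<Sum>i\<in>UNIV. q $ i) - (\<Sum>i\<in>UNIV. r $ i) \<le> relative_entropy q r"
  unfolding relative_entropy_def sum_subtractf[symmetric]
proof (rule sum_mono)
  fix i
  show "q $ i - r $ i \<le> q $ i * ln (q $ i / r $ i)"
  proof (cases "q $ i = 0")
    case False
    with q[of i] have q0: "0 < q $ i" by simp
    have "- ln (q $ i / r $ i) = ln (r $ i / q $ i)"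
      using q0 r[of i] by (simp add: ln_div)
    also have "\<dots> \<le> r $ i / q $ i - 1"
      using q0 r[of i] by (intro ln_le_minus_one) simp
    finally have "q $ i * - ln (q $ i / r $ i) \<le> q $ i * (r $ i / q $ i - 1)"
      using q0 by (intro mult_left_mono) auto
    then show ?thesis using q0 by (simp add: right_diff_distrib)
  qed (use r[of i] in simp)
qed

lemma relative_entropy_split:
  assumes q: "\<And>i. 0 \<le> q $ i" and p: "\<And>i. 0 < p $ i" and F: "\<And>i. 0 < F $ i"
  shows "relative_entropy q F = relative_entropy q p + (\<Sum>i\<in>UNIV. q $ i * ln (p $ i / F $ i))"
  unfolding relative_entropy_def sum.distrib[symmetric]
proof (rule sum.cong[OF refl])
  fix i
  show "q $ i * ln (q $ i / F $ i) = q $ i * ln (q $ i / p $ i) + q $ i * ln (p $ i / F $ i)"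
    using q[of i] p[of i] F[of i] by (cases "q $ i = 0") (auto simp: ln_div algebra_simps)
qed

lemma relative_entropy_reweight:
  assumes q: "\<And>i. 0 \<le> q $ i" and F: "\<And>i. 0 < F $ i"
  shows "relative_entropy q (\<chi> i. exp (- g i) * F $ i) = relative_entropy q F + (\<Sum>i\<in>UNIV. q $ i * g i)"
proof -
  have "ln (F $ i / (exp (- g i) * F $ i)) = g i" for i
    using F[of i] by (simp add: ln_div ln_mult)
  then show ?thesis
    using relative_entropy_split[of q F "\<chi> i. exp (- g i) * F $ i"] q F by simp
qed

lemma bregman_scaling_exists:
  fixes F :: "real ^ 'm::finite"
  assumes F: "\<And>i. 0 < F $ i" and s: "s \<le> CARD('m)"
  shows "\<exists>c\<ge>0. (\<Sum>i\<in>UNIV. min 1 (c * F $ i)) = real s"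
proof -
  define C where "C = (\<Sum>i\<in>UNIV. 1 / F $ i)"
  have C: "0 \<le> C" unfolding C_def using F by (intro sum_nonneg) (simp add: less_imp_le)
  have "1 \<le> C * F $ i" for i
  proof -
    have "1 / F $ i \<le> C"
      unfolding C_def using F by (intro member_le_sum) (simp_all add: less_imp_le)
    then show ?thesis using F[of i] by (simp add: divide_le_eq)
  qed
  then have "(\<Sum>i\<in>UNIV. min 1 (C * F $ i)) = real CARD('m)"
    by (simp add: min_absorb1)
  moreover have "continuous_on {0..C} (\<lambda>c. \<Sum>i\<in>UNIV. min 1 (c * F $ i))"
    by (intro continuous_intros)
  ultimately show ?thesis
    using IVT'[of "\<lambda>c. \<Sum>i\<in>UNIV. min 1 (c * F $ i)" 0 "real s" C] s C by auto
qed

text \<open>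
  A name for the choice inside \<open>bregman_projection\<close>, so that its dependence on \<open>F\<close> can be studied.
\<close>

definition bregman_factor :: "nat \<Rightarrow> real ^ 'm::finite \<Rightarrow> real" where
  "bregman_factor s F = (SOME c. 0 \<le> c \<and> (\<Sum>i\<in>UNIV. min 1 (c * F $ i)) = real s)"

lemma bregman_projection_nth:
  "bregman_projection s F $ i = 1 / real s * min 1 (bregman_factor s F * F $ i)"
  by (simp add: bregman_projection_def bregman_factor_def Let_def)

context
  fixes F :: "real ^ 'm::finite" and s :: nat
  assumes F: "\<And>i. 0 < F $ i" and s: "1 \<le> s" "s \<le> CARD('m)"
begin

lemma bregman_factor:
  "0 < bregman_factor s F" "(\<Sum>i\<in>UNIV. min 1 (bregman_factor s F * F $ i)) = real s"
proof -
  have *: "0 \<le> bregman_factor s F \<and> (\<Sum>i\<in>UNIV. min 1 (bregman_factor s F * F $ i)) = real s"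
    unfolding bregman_factor_def
    by (rule someI_ex[OF bregman_scaling_exists[OF F s(2)]])
  then show "(\<Sum>i\<in>UNIV. min 1 (bregman_factor s F * F $ i)) = real s" by blast
  show "0 < bregman_factor s F"
    using * s(1) by (cases "bregman_factor s F = 0") auto
qed

lemma bregman_projection_pos: "0 < bregman_projection s F $ i"
  using bregman_factor(1) F[of i] s(1) by (simp add: bregman_projection_nth)

lemma bregman_projection_le: "bregman_projection s F $ i \<le> 1 / real s"
  by (simp add: bregman_projection_nth divide_right_mono)

lemma sum_bregman_projection: "(\<Sum>i\<in>UNIV. bregman_projection s F $ i) = 1"
  using bregman_factor(2) s(1)
  by (simp add: bregman_projection_nth flip: sum_divide_distrib)

lemma distribution_bregman_projection: "distribution (bregman_projection s F)"
  using bregman_projection_pos sum_bregman_projection by (simp add: distribution_def less_imp_le)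

text \<open>
  The projection minimises relative entropy to \<open>F\<close> over the distributions bounded by \<open>1/s\<close>. This
  is its first-order optimality condition in integrated form.
\<close>

lemma bregman_pythagoras:
  assumes q: "\<And>i. 0 \<le> q $ i" "\<And>i. q $ i \<le> 1 / real s" "(\<Sum>i\<in>UNIV. q $ i) = 1"
  shows "relative_entropy q (bregman_projection s F) + relative_entropy (bregman_projection s F) F
    \<le> relative_entropy q F"
proof -
  define p where "p = bregman_projection s F"
  define c where "c = bregman_factor s F"
  have c: "0 < c" by (simp add: c_def bregman_factor)
  have p: "p $ i = 1 / real s * min 1 (c * F $ i)" for i
    by (simp add: p_def c_def bregman_projection_nth)
  \<comment> \<open>Where the cap is inactive, \<open>p / F\<close> is the constant \<open>c / s\<close>; where it is active,
    \<open>p\<close> is maximal and \<open>p / F\<close> is below that constant.\<close>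
  have "0 \<le> (q $ i - p $ i) * (ln (p $ i / F $ i) - ln (c / s))" for i
  proof (cases "c * F $ i \<le> 1")
    case True
    then have "p $ i / F $ i = c / s" using F[of i] by (simp add: p)
    then show ?thesis by simp
  next
    case False
    then have pi: "p $ i = 1 / s" by (simp add: p)
    have "p $ i / F $ i \<le> c / s" using F[of i] s(1) False by (simp add: pi field_simps)
    then have "ln (p $ i / F $ i) \<le> ln (c / s)"
      using F[of i] s(1) c by (simp add: pi)
    moreover have "q $ i \<le> p $ i" using q(2) by (simp add: pi)
    ultimately show ?thesis by (intro mult_nonpos_nonpos) auto
  qed
  then have "0 \<le> (\<Sum>i\<in>UNIV. (q $ i - p $ i) * (ln (p $ i / F $ i) - ln (c / s)))"
    by (intro sum_nonneg) blast
  also have "\<dots> = (\<Sum>i\<in>UNIV. (q $ i - p $ i) * ln (p $ i / F $ i))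
      - (\<Sum>i\<in>UNIV. q $ i - p $ i) * ln (c / s)"
    by (simp only: right_diff_distrib[of _ "ln _"] sum_subtractf[of "\<lambda>i. _ i * _ i"] sum_distrib_right)
  also have "(\<Sum>i\<in>UNIV. q $ i - p $ i) = 0"
    by (simp add: sum_subtractf q(3) p_def sum_bregman_projection)
  finally have "(\<Sum>i\<in>UNIV. p $ i * ln (p $ i / F $ i)) \<le> (\<Sum>i\<in>UNIV. q $ i * ln (p $ i / F $ i))"
    by (simp add: left_diff_distrib sum_subtractf)
  moreover have "relative_entropy q F = relative_entropy q p + (\<Sum>i\<in>UNIV. q $ i * ln (p $ i / F $ i))"
    using q(1) F bregman_projection_pos by (intro relative_entropy_split) (auto simp: p_def)
  ultimately show ?thesis by (simp add: relative_entropy_def p_def)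
qed

lemma relative_entropy_projection_le:
  assumes q: "\<And>i. 0 \<le> q $ i" "\<And>i. q $ i \<le> 1 / real s" "(\<Sum>i\<in>UNIV. q $ i) = 1"
  shows "relative_entropy (bregman_projection s F) F \<le> relative_entropy q F"
proof -
  have "0 \<le> relative_entropy q (bregman_projection s F)"
    using relative_entropy_ge[of q "bregman_projection s F"] q bregman_projection_pos
    by (simp add: sum_bregman_projection)
  then show ?thesis using bregman_pythagoras[OF q] by linarith
qed

end

text \<open>
  The step size of the algorithm may exceed \<open>1\<close>, so an estimate for small arguments only would not
  suffice.
\<close>

lemma exp_minus_le_quadratic:
  fixes z :: real
  assumes "0 \<le> z"
  shows "exp (- z) \<le> 1 - z + z\<^sup>2 / 2"
proof -
  have "1 \<le> (1 - z + z\<^sup>2 / 2) * (1 + z + z\<^sup>2 / 2)"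
  proof -
    have "(1 - z + z\<^sup>2 / 2) * (1 + z + z\<^sup>2 / 2) = 1 + (z\<^sup>2)\<^sup>2 / 4"
      by (simp add: power2_eq_square algebra_simps)
    then show ?thesis by simp
  qed
  also have "\<dots> \<le> (1 - z + z\<^sup>2 / 2) * exp z"
  proof (rule mult_left_mono)
    have "1 - z + z\<^sup>2 / 2 = ((1 - z)\<^sup>2 + 1) / 2" by (simp add: power2_eq_square field_simps)
    moreover have "0 \<le> ((1 - z)\<^sup>2 + 1) / 2" by simp
    ultimately show "0 \<le> 1 - z + z\<^sup>2 / 2" by (simp only:)
  qed (rule exp_lower_Taylor_quadratic[OF assms])
  finally show ?thesis by (simp add: exp_minus field_simps)
qed

text \<open>
  The new potential is the relative entropy of the new projection \<open>q\<close> to \<open>F\<close> plus its weighted loss.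
  The Pythagorean inequality at the old projection \<open>p\<close> splits off the old potential. What remains is
  the entropy of \<open>q\<close> relative to \<open>p\<close> reweighted by the losses; Gibbs' inequality bounds it below
  independently of \<open>q\<close>.
\<close>

lemma potential_step:
  fixes F :: "real ^ 'm::finite"
  assumes F: "\<And>i. 0 < F $ i" and s: "1 \<le> s" "s \<le> CARD('m)"
    and l: "\<And>i. 0 \<le> l i" "\<And>i. l i \<le> 1" and \<eta>: "0 \<le> \<eta>"
  defines "F' \<equiv> \<chi> i. exp (- \<eta> * l i) * F $ i"
  shows "relative_entropy (bregman_projection s F) F
      + \<eta> * (\<Sum>i\<in>UNIV. bregman_projection s F $ i * l i) - \<eta>\<^sup>2 / 2
    \<le> relative_entropy (bregman_projection s F') F'"
proof -
  define p where "p = bregman_projection s F"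
  define q where "q = bregman_projection s F'"
  have F': "0 < F' $ i" for i using F by (simp add: F'_def)
  have p: "0 < p $ i" for i using bregman_projection_pos[OF F s] by (simp add: p_def)
  have q: "0 \<le> q $ i" "q $ i \<le> 1 / s" "(\<Sum>i\<in>UNIV. q $ i) = 1" for i
    using bregman_projection_pos[OF F' s] bregman_projection_le[OF F' s] sum_bregman_projection[OF F' s]
    by (simp_all add: q_def less_imp_le)
  \<comment> \<open>The unnormalised multiplicative update of \<open>p\<close>.\<close>
  define r where "r = (\<chi> i. exp (- (\<eta> * l i)) * p $ i)"
  have "r $ i \<le> p $ i - \<eta> * (p $ i * l i) + \<eta>\<^sup>2 / 2 * p $ i" for i
  proof -
    have "exp (- (\<eta> * l i)) \<le> 1 - \<eta> * l i + (\<eta> * l i)\<^sup>2 / 2"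
      using \<eta> l by (intro exp_minus_le_quadratic) simp
    also have "(\<eta> * l i)\<^sup>2 \<le> \<eta>\<^sup>2"
      using \<eta> l by (intro power_mono) (auto simp: mult_left_le)
    finally have "exp (- (\<eta> * l i)) * p $ i \<le> (1 - \<eta> * l i + \<eta>\<^sup>2 / 2) * p $ i"
      using p[of i] by (intro mult_right_mono) auto
    then show ?thesis by (simp add: r_def algebra_simps)
  qed
  then have "(\<Sum>i\<in>UNIV. r $ i) \<le> (\<Sum>i\<in>UNIV. p $ i - \<eta> * (p $ i * l i) + \<eta>\<^sup>2 / 2 * p $ i)"
    by (rule sum_mono)
  also have "\<dots> = 1 - \<eta> * (\<Sum>i\<in>UNIV. p $ i * l i) + \<eta>\<^sup>2 / 2"
    using sum_bregman_projection[OF F s]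
    by (simp add: p_def sum.distrib sum_subtractf flip: sum_distrib_left sum_divide_distrib)
  finally have r: "(\<Sum>i\<in>UNIV. r $ i) \<le> 1 - \<eta> * (\<Sum>i\<in>UNIV. p $ i * l i) + \<eta>\<^sup>2 / 2" .
  have "1 - (\<Sum>i\<in>UNIV. r $ i) \<le> relative_entropy q r"
    using relative_entropy_ge[of q r] q p by (simp add: r_def)
  also have "\<dots> = relative_entropy q p + (\<Sum>i\<in>UNIV. q $ i * (\<eta> * l i))"
    unfolding r_def using q p by (intro relative_entropy_reweight) auto
  also have "\<dots> \<le> relative_entropy q F - relative_entropy p F + (\<Sum>i\<in>UNIV. q $ i * (\<eta> * l i))"
    using bregman_pythagoras[OF F s q] by (simp add: p_def)
  also have "\<dots> = relative_entropy q F' - relative_entropy p F"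
    using relative_entropy_reweight[of q F "\<lambda>i. \<eta> * l i"] q F by (simp add: F'_def)
  finally show ?thesis using r by (simp add: p_def q_def)
qed

lemma relative_entropy_uniform_on:
  fixes F :: "real ^ 'm::finite"
  assumes S: "S \<noteq> {}" and F: "\<And>i. F $ i = exp (- g i)"
  shows "relative_entropy (\<chi> i. if i \<in> S then 1 / card S else 0) F
    = (\<Sum>i\<in>S. g i) / card S - ln (card S)"
proof -
  have S0: "0 < card S" using S by (simp add: card_gt_0_iff)
  have "relative_entropy (\<chi> i. if i \<in> S then 1 / card S else 0) F
    = (\<Sum>i\<in>S. 1 / card S * ln (1 / card S / F $ i))"
    unfolding relative_entropy_def by (intro sum.mono_neutral_cong_right) auto
  also have "\<dots> = (\<Sum>i\<in>S. g i / card S - ln (card S) / card S)"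
  proof (intro sum.cong refl)
    fix i
    have "1 / card S / F $ i = exp (g i) / card S" by (simp add: F exp_minus field_simps)
    then show "1 / card S * ln (1 / card S / F $ i) = g i / card S - ln (card S) / card S"
      using S0 by (simp only:) (simp add: ln_div diff_divide_distrib)
  qed
  finally show ?thesis
    using S0 by (simp add: sum_subtractf flip: sum_divide_distrib)
qed

section \<open>The rounds as a measurable kernel\<close>

lemma borel_measurable_vecI:
  fixes f :: "'b \<Rightarrow> real ^ 'm::finite"
  assumes "\<And>i. (\<lambda>x. f x $ i) \<in> borel_measurable M"
  shows "f \<in> borel_measurable M"
  by (subst borel_measurable_euclidean_space) (auto simp: Basis_vec_def inner_axis assms)

text \<open>
  The factor is defined implicitly, by an equation that is monotone in it. Its sublevel sets are
  therefore explicit sets of \<open>F\<close>, which yields its measurability.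
\<close>

lemma bregman_factor_le_iff:
  fixes F :: "real ^ 'm::finite"
  assumes F: "\<And>i. 0 < F $ i" and s: "1 \<le> s" "s < CARD('m)"
  shows "bregman_factor s F \<le> t \<longleftrightarrow> real s \<le> (\<Sum>i\<in>UNIV. min 1 (t * F $ i))"
proof -
  define g where "g t = (\<Sum>i\<in>UNIV. min 1 (t * F $ i))" for t
  define c where "c = bregman_factor s F"
  have gc: "g c = s" using bregman_factor(2)[OF F] s by (simp add: g_def c_def)
  have mono: "g t \<le> g t'" if "t \<le> t'" for t t'
    unfolding g_def using that F
    by (intro sum_mono min.mono mult_right_mono) (auto simp: less_imp_le)
  have "g t < s" if "t < c" for t
  proof (rule ccontr)
    assume "\<not> g t < s"
    then have "g t = s" using mono[of t c] that gc by simp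
    \<comment> \<open>As \<open>s < CARD('m)\<close>, some coordinate is not capped at \<open>t\<close>, so the sum still grows there.\<close>
    have "\<exists>i. t * F $ i < 1"
    proof (rule ccontr)
      assume "\<not> ?thesis"
      then have "g t = real CARD('m)" by (simp add: g_def min_absorb1 not_less)
      then show False using \<open>g t = s\<close> s(2) by simp
    qed
    then obtain i where i: "t * F $ i < 1" by blast
    have "t * F $ i < c * F $ i" using that F[of i] by simp
    then have "min 1 (t * F $ i) < min 1 (c * F $ i)" using i by auto
    moreover have "min 1 (t * F $ j) \<le> min 1 (c * F $ j)" for j
      using that F[of j] by (intro min.mono mult_right_mono) auto
    ultimately have "g t < g c"
      unfolding g_def by (intro sum_strict_mono_ex1) auto
    then show False using gc \<open>g t = s\<close> by simp
  qed
  then show ?thesis using mono[of c t] gc by (auto simp: g_def c_def not_le[symmetric])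
qed

text \<open>
  For \<open>s = CARD('m)\<close> the factor is not determined by \<open>F\<close>, so this case is settled without it.
\<close>

lemma measurable_bregman_projection:
  fixes f :: "'b \<Rightarrow> real ^ 'm::finite"
  assumes f [measurable]: "f \<in> borel_measurable M"
    and pos: "\<And>x i. x \<in> space M \<Longrightarrow> 0 < f x $ i" and s: "1 \<le> s" "s \<le> CARD('m)"
  shows "(\<lambda>x. bregman_projection s (f x)) \<in> M \<rightarrow>\<^sub>M restrict_space borel {y. distribution y}"
proof (rule measurable_restrict_space2)
  show "(\<lambda>x. bregman_projection s (f x)) \<in> space M \<rightarrow> {y. distribution y}"
    using distribution_bregman_projection pos s by blast
  have nth [measurable]: "(\<lambda>x. f x $ i) \<in> borel_measurable M" for i
    by (rule measurable_compose[OF f borel_measurable_nth])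
  show "(\<lambda>x. bregman_projection s (f x)) \<in> borel_measurable M"
  proof (cases "s < CARD('m)")
    case True
    have [measurable]: "(\<lambda>x. bregman_factor s (f x)) \<in> borel_measurable M"
    proof (rule borel_measurableI_le)
      fix t
      have "{x \<in> space M. bregman_factor s (f x) \<le> t}
          = {x \<in> space M. real s \<le> (\<Sum>i\<in>UNIV. min 1 (t * f x $ i))}"
        using bregman_factor_le_iff pos s(1) True by blast
      also have "\<dots> \<in> sets M" by measurable
      finally show "{x \<in> space M. bregman_factor s (f x) \<le> t} \<in> sets M" .
    qed
    show ?thesis
      by (rule borel_measurable_vecI) (simp add: bregman_projection_nth)
  next
    case False
    \<comment> \<open>The capped distribution is forced to be uniform.\<close>
    have "bregman_projection s (f x) = (\<chi> i. 1 / real s)" if x: "x \<in> space M" for x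
    proof -
      let ?p = "bregman_projection s (f x)"
      have "(\<Sum>i\<in>UNIV. 1 / real s - ?p $ i) = 0"
        using sum_bregman_projection[OF pos[OF x] s] False s by (simp add: sum_subtractf)
      moreover have "0 \<le> 1 / real s - ?p $ i" for i
        using bregman_projection_le[OF pos[OF x] s] by simp
      ultimately have "1 / real s - ?p $ i = 0" for i
        by (subst (asm) sum_nonneg_eq_0_iff) auto
      then show ?thesis by (simp add: vec_eq_iff)
    qed
    then show ?thesis by (subst measurable_cong[where g = "\<lambda>_. \<chi> i. 1 / real s"]) auto
  qed
qed

lemma measurable_loss [measurable]: "(\<lambda>x. loss a b \<rho> x $ i) \<in> borel_measurable borel"
  unfolding loss_def by simp

text \<open>
  On positive measures the projection is always well defined, and the updates preserve positivity,
  so these measures form the state space of the kernels below.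
\<close>

abbreviation positive_measures :: "(real ^ 'm::finite) measure" where
  "positive_measures \<equiv> restrict_space borel {F. \<forall>i. 0 < F $ i}"

lemma measurable_state_update:
  fixes a :: "'a::euclidean_space ^ 'm::finite"
  shows "(\<lambda>((F, X), x). (\<chi> i. exp (- \<eta> * loss a b \<rho> x $ i) * F $ i, X + x))
    \<in> (positive_measures \<Otimes>\<^sub>M borel) \<Otimes>\<^sub>M borel \<rightarrow>\<^sub>M positive_measures \<Otimes>\<^sub>M (borel :: 'a measure)"
proof -
  let ?N = "(positive_measures \<Otimes>\<^sub>M borel) \<Otimes>\<^sub>M borel :: (((real ^ 'm) \<times> 'a) \<times> 'a) measure"
  have [measurable]: "(\<lambda>F. F $ i) \<in> borel_measurable positive_measures" for i
    by (intro measurable_restrict_space1) measurable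
  have "(\<lambda>((F, X), x). \<chi> i. exp (- \<eta> * loss a b \<rho> x $ i) * F $ i) \<in> ?N \<rightarrow>\<^sub>M positive_measures"
  proof (rule measurable_restrict_space2)
    show "(\<lambda>((F, X), x). \<chi> i. exp (- \<eta> * loss a b \<rho> x $ i) * F $ i) \<in> borel_measurable ?N"
      by (rule borel_measurable_vecI) (simp add: case_prod_beta)
  qed (auto simp: space_pair_measure space_restrict_space)
  moreover have "(\<lambda>z. snd (fst z) + snd z) \<in> borel_measurable ?N"
    by measurable
  ultimately have "(\<lambda>z. ((\<lambda>((F, X), x). \<chi> i. exp (- \<eta> * loss a b \<rho> x $ i) * F $ i) z,
      snd (fst z) + snd z)) \<in> ?N \<rightarrow>\<^sub>M positive_measures \<Otimes>\<^sub>M borel"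
    by (rule measurable_Pair)
  then show ?thesis by (simp add: case_prod_unfold)
qed

context
  fixes orac :: "real ^ 'm::finite \<Rightarrow> 'a::euclidean_space measure"
    and a :: "'a ^ 'm" and b :: "real ^ 'm" and \<rho> \<eta> :: real and s :: nat
  assumes orac: "orac \<in> restrict_space borel {y. distribution y} \<rightarrow>\<^sub>M prob_algebra borel"
    and s: "1 \<le> s" "s \<le> CARD('m)"
begin

text \<open>
  The monadic bind integrates over its first argument only if the continuation is a measurable
  kernel, so every quantitative statement about the rounds depends on this lemma.
\<close>

lemma measurable_dense_mw_rounds:
  "(\<lambda>(F, X). dense_mw_rounds orac a b \<rho> s \<eta> n F X) \<in> positive_measures \<Otimes>\<^sub>M borel \<rightarrow>\<^sub>M prob_algebra borel"
proof (induction n)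
  case 0
  then show ?case by simp
next
  case (Suc n)
  let ?N = "positive_measures \<Otimes>\<^sub>M borel :: ((real ^ 'm) \<times> 'a) measure"
  have "(\<lambda>z. bregman_projection s (fst z)) \<in> ?N \<rightarrow>\<^sub>M restrict_space borel {y. distribution y}"
  proof (rule measurable_bregman_projection[OF _ _ s])
    show "fst \<in> borel_measurable ?N"
      by (rule measurable_compose[OF measurable_fst measurable_restrict_space1]) simp
  qed (auto simp: space_pair_measure space_restrict_space)
  then have "(\<lambda>z. orac (bregman_projection s (fst z))) \<in> ?N \<rightarrow>\<^sub>M prob_algebra borel"
    by (rule measurable_compose[OF _ orac])
  moreover have "(\<lambda>(z, x). dense_mw_rounds orac a b \<rho> s \<eta> n
      (\<chi> i. exp (- \<eta> * loss a b \<rho> x $ i) * fst z $ i) (snd z + x)) \<in> ?N \<Otimes>\<^sub>M borel \<rightarrow>\<^sub>M prob_algebra borel"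
    using measurable_compose[OF measurable_state_update[of \<eta> a b \<rho>] Suc] by (simp add: case_prod_beta)
  ultimately have "(\<lambda>z. bind (orac (bregman_projection s (fst z))) (\<lambda>x. dense_mw_rounds orac a b \<rho> s \<eta> n
      (\<chi> i. exp (- \<eta> * loss a b \<rho> x $ i) * fst z $ i) (snd z + x))) \<in> ?N \<rightarrow>\<^sub>M prob_algebra borel"
    by (rule measurable_bind_prob_space2)
  then show ?case by (simp add: case_prod_beta)
qed

lemma dense_mw_rounds_in_prob_algebra:
  assumes "\<And>i. 0 < F $ i"
  shows "dense_mw_rounds orac a b \<rho> s \<eta> n F X \<in> space (prob_algebra borel)"
  using measurable_space[OF measurable_dense_mw_rounds[of n], of "(F, X)"] assms
  by (simp add: space_pair_measure space_restrict_space)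

text \<open>
  The union bound over the rounds. The argument \<open>n\<close> of the invariant counts the remaining rounds.
  The probability of a fixed final event \<open>E\<close> is bounded; the detour through an invariant avoids
  measurability questions about the set of good trajectories.
\<close>

lemma dense_mw_rounds_invariant:
  assumes good: "\<And>y. distribution y \<Longrightarrow> good y \<in> sets borel"
      "\<And>y. distribution y \<Longrightarrow> 1 - \<beta>\<^sub>0 \<le> measure (orac y) (good y)"
    and \<beta>: "0 \<le> \<beta>\<^sub>0"
    and E: "E \<in> sets borel"
    and pos: "\<And>n F X i. I n F X \<Longrightarrow> 0 < F $ i"
    and step: "\<And>n F X x. \<lbrakk>I (Suc n) F X; x \<in> good (bregman_projection s F)\<rbrakk>
      \<Longrightarrow> I n (\<chi> i. exp (- \<eta> * loss a b \<rho> x $ i) * F $ i) (X + x)"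
    and final: "\<And>F X. I 0 F X \<Longrightarrow> X \<in> E"
  shows "I n F X \<Longrightarrow> 1 - real n * \<beta>\<^sub>0 \<le> measure (dense_mw_rounds orac a b \<rho> s \<eta> n F X) E"
proof (induction n arbitrary: F X)
  case 0
  then show ?case using final E by (simp add: measure_return)
next
  case (Suc n)
  define y where "y = bregman_projection s F"
  define K where "K x = dense_mw_rounds orac a b \<rho> s \<eta> n
    (\<chi> i. exp (- \<eta> * loss a b \<rho> x $ i) * F $ i) (X + x)" for x
  have y: "distribution y"
    unfolding y_def using pos[OF Suc.prems] s by (rule distribution_bregman_projection)
  have "orac y \<in> space (prob_algebra borel)"
    using measurable_space[OF orac, of y] y by (simp add: space_restrict_space)
  then have sets [measurable_cong, simp]: "sets (orac y) = sets borel" and "prob_space (orac y)"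
    by (auto simp: space_prob_algebra)
  then interpret prob_space "orac y" by simp
  have "(\<lambda>x. ((F, X), x)) \<in> borel \<rightarrow>\<^sub>M (positive_measures \<Otimes>\<^sub>M borel) \<Otimes>\<^sub>M borel"
    using pos[OF Suc.prems] by (intro measurable_Pair measurable_const measurable_ident)
      (auto simp: space_pair_measure space_restrict_space)
  from measurable_compose[OF measurable_compose[OF this measurable_state_update[of \<eta> a b \<rho>]] measurable_dense_mw_rounds[of n]]
  have "K \<in> borel \<rightarrow>\<^sub>M prob_algebra borel"
    by (simp add: K_def[abs_def])
  then have K: "K \<in> orac y \<rightarrow>\<^sub>M subprob_algebra borel"
    by (simp add: measurable_prob_algebraD cong: measurable_cong_sets)
  have Kp: "prob_space (K x)" for x
    using measurable_space[OF \<open>K \<in> borel \<rightarrow>\<^sub>M prob_algebra borel\<close>, of x] by (simp add: space_prob_algebra)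
  have g: "good y \<in> events" using good(1)[OF y] by simp
  have int: "integrable (orac y) (indicat_real (good y))"
    using g by (intro integrable_real_indicator) (auto simp: emeasure_eq_measure)
  have m: "(\<lambda>x. measure (K x) E) \<in> borel_measurable (orac y)"
    using E sets.top[of "orac y"] by (intro measure_measurable_subprob_algebra2[OF pair_measureI K]) simp_all
  have "1 - real (Suc n) * \<beta>\<^sub>0 \<le> prob (good y) - real n * \<beta>\<^sub>0"
    using good(2)[OF y] by (simp add: algebra_simps)
  \<comment> \<open>On the complement of the good event the integrand is nonpositive, so no factor
    \<open>1 - real n * \<beta>\<^sub>0\<close> of unknown sign has to be multiplied.\<close>
  also have "\<dots> = (\<integral>x. indicator (good y) x - real n * \<beta>\<^sub>0 \<partial>orac y)"
    using g int by (subst Bochner_Integration.integral_diff) (simp_all add: prob_space)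
  also have "\<dots> \<le> (\<integral>x. measure (K x) E \<partial>orac y)"
  proof (rule integral_mono)
    show "integrable (orac y) (\<lambda>x. measure (K x) E)"
      using m Kp by (intro integrable_const_bound[where B = 1]) (auto simp: prob_space.prob_le_1)
    show "integrable (orac y) (\<lambda>x. indicator (good y) x - real n * \<beta>\<^sub>0)"
      using int by simp
    fix x
    show "indicator (good y) x - real n * \<beta>\<^sub>0 \<le> measure (K x) E"
    proof (cases "x \<in> good y")
      case True
      then show ?thesis
        using Suc.IH[OF step[OF Suc.prems]] by (simp add: y_def K_def)
    next
      case False
      have "- (real n * \<beta>\<^sub>0) \<le> 0" using \<beta> by simp
      also have "0 \<le> measure (K x) E" by simp
      finally show ?thesis using False by simp
    qed
  qed
  also have "\<dots> = measure (orac y \<bind> K) E"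
    using measure_bind[OF K E] by simp
  finally show ?case by (simp add: y_def K_def[abs_def])
qed

end

section \<open>Accuracy of the averaged answer\<close>

text \<open>
  A feasible point has objective value at most the weighted right-hand sides, hence so has the
  minimum. The width makes the objective bounded below on \<open>K\<close>, so the infimum is below that value.
\<close>

lemma oracle_answer_loss:
  fixes a :: "'a::euclidean_space ^ 'm::finite"
  assumes width: "width_bound K a b \<rho>" and \<rho>: "0 < \<rho>"
    and x0: "x\<^sub>0 \<in> K" "\<And>i. a $ i \<bullet> x\<^sub>0 \<le> b $ i"
    and y: "distribution y"
    and x: "(\<Sum>i\<in>UNIV. y $ i *\<^sub>R a $ i) \<bullet> x \<le> (INF z\<in>K. (\<Sum>i\<in>UNIV. y $ i *\<^sub>R a $ i) \<bullet> z) + \<alpha>\<^sub>0"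
  shows "1 / 2 - \<alpha>\<^sub>0 / (2 * \<rho>) \<le> (\<Sum>i\<in>UNIV. y $ i * loss a b \<rho> x $ i)"
proof -
  define A where "A z = (\<Sum>i\<in>UNIV. y $ i * (a $ i \<bullet> z))" for z
  have A: "(\<Sum>i\<in>UNIV. y $ i *\<^sub>R a $ i) \<bullet> z = A z" for z
    by (simp add: A_def inner_sum_left)
  have y0: "0 \<le> y $ i" and y1: "(\<Sum>i\<in>UNIV. y $ i) = 1" for i
    using y by (auto simp: distribution_def)
  have "(\<Sum>i\<in>UNIV. y $ i * (b $ i - \<rho>)) \<le> A z" if "z \<in> K" for z
  proof -
    have "b $ i - \<rho> \<le> a $ i \<bullet> z" for i
      using width that unfolding width_bound_def by (smt (verit))
    then show ?thesis unfolding A_def using y0 by (intro sum_mono mult_left_mono) auto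
  qed
  then have "bdd_below (A ` K)" by (rule bdd_belowI2)
  then have "(INF z\<in>K. A z) \<le> A x\<^sub>0" using x0(1) by (rule cINF_lower)
  also have "\<dots> \<le> (\<Sum>i\<in>UNIV. y $ i * b $ i)"
    unfolding A_def using y0 x0(2) by (intro sum_mono mult_left_mono) auto
  finally have "A x \<le> (\<Sum>i\<in>UNIV. y $ i * b $ i) + \<alpha>\<^sub>0" using x by (simp add: A)
  then have "- \<alpha>\<^sub>0 / (2 * \<rho>) \<le> ((\<Sum>i\<in>UNIV. y $ i * b $ i) - A x) / (2 * \<rho>)"
    using \<rho> by (intro divide_right_mono) auto
  also have "\<dots> = (\<Sum>i\<in>UNIV. y $ i * loss a b \<rho> x $ i - y $ i / 2)"
    unfolding A_def sum_subtractf[symmetric] sum_divide_distrib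
    by (intro sum.cong) (auto simp: loss_def algebra_simps diff_divide_distrib add_divide_distrib)
  also have "\<dots> = (\<Sum>i\<in>UNIV. y $ i * loss a b \<rho> x $ i) - 1 / 2"
    by (simp add: sum_subtractf y1 flip: sum_divide_distrib)
  finally show ?thesis by simp
qed

lemma loss_bounds:
  assumes "\<bar>a $ i \<bullet> x - b $ i\<bar> \<le> \<rho>" "0 < \<rho>"
  shows "0 \<le> loss a b \<rho> x $ i" "loss a b \<rho> x $ i \<le> 1"
  using assms by (auto simp: loss_def field_simps abs_le_iff)

text \<open>
  \<open>F\<close> is the measure after \<open>T\<close> rounds whose answers sum to \<open>X\<close>. If many constraints were violated,
  the uniform distribution on their indices would be admissible for the projection, and its
  relative entropy to \<open>F\<close> would be below the potential: the margin \<open>\<alpha>/(3\<rho>)\<close> between the average losses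
  exceeds the error \<open>3\<eta>/2\<close>, which consists of \<open>\<eta>/2\<close> from the rounds and \<open>ln CARD('m) / (T \<eta>) = \<eta>\<close>
  from the initial entropy.
\<close>

lemma few_violated_constraints:
  fixes a :: "'a::euclidean_space ^ 'm::finite" and F b :: "real ^ 'm" and T :: real
  assumes s: "1 \<le> s" "s \<le> CARD('m)"
    and pos: "0 < \<rho>" "0 < \<alpha>" "0 < \<eta>" "0 < T"
    and \<eta>: "T * \<eta>\<^sup>2 = ln (real CARD('m))" "\<eta> \<le> \<alpha> / (6 * \<rho>)"
    and F: "\<And>i. F $ i = exp (- (ln (real CARD('m)) + \<eta> * (T * (b $ i / (2 * \<rho>) + 1 / 2) - (a $ i \<bullet> X) / (2 * \<rho>))))"
    and potential: "T * (\<eta> * (1 / 2 - \<alpha> / (6 * \<rho>)) - \<eta>\<^sup>2 / 2) \<le> relative_entropy (bregman_projection s F) F"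
  shows "card {i. a $ i \<bullet> ((1 / T) *\<^sub>R X) > b $ i + \<alpha>} < s"
proof (rule ccontr)
  define S where "S = {i. a $ i \<bullet> ((1 / T) *\<^sub>R X) > b $ i + \<alpha>}"
  define g where "g i = ln (real CARD('m)) + \<eta> * (T * (b $ i / (2 * \<rho>) + 1 / 2) - (a $ i \<bullet> X) / (2 * \<rho>))" for i
  define G where "G = T * \<eta>\<^sup>2 + \<eta> * (T * (1 / 2 - \<alpha> / (2 * \<rho>)))"
  define u :: "real ^ 'm" where "u = (\<chi> i. if i \<in> S then 1 / card S else 0)"
  assume "\<not> ?thesis"
  then have cS: "s \<le> card S" by (simp add: S_def)
  with s(1) have S: "0 < card S" "S \<noteq> {}" by (linarith, fastforce)
  have "g i < G" if "i \<in> S" for i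
  proof -
    have "T * (b $ i + \<alpha>) < a $ i \<bullet> X"
      using that pos(4) by (simp add: S_def field_simps)
    then have "T * (b $ i + \<alpha>) / (2 * \<rho>) < (a $ i \<bullet> X) / (2 * \<rho>)"
      using pos(1) by (intro divide_strict_right_mono) auto
    then have "T * (b $ i / (2 * \<rho>) + 1 / 2) - (a $ i \<bullet> X) / (2 * \<rho>) < T * (1 / 2 - \<alpha> / (2 * \<rho>))"
      by (simp add: algebra_simps add_divide_distrib)
    then show ?thesis using pos(3) by (simp add: g_def G_def \<eta>(1))
  qed
  then have "(\<Sum>i\<in>S. g i) < (\<Sum>i\<in>S. G)" using S by (intro sum_strict_mono) auto
  then have "(\<Sum>i\<in>S. g i) / card S < G" using S(1) by (simp add: divide_less_eq mult.commute)
  moreover have "relative_entropy u F = (\<Sum>i\<in>S. g i) / card S - ln (card S)"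
    unfolding u_def using S(2) by (rule relative_entropy_uniform_on) (simp add: F g_def)
  moreover have "0 \<le> ln (card S)" using S(1) by simp
  moreover have "relative_entropy (bregman_projection s F) F \<le> relative_entropy u F"
  proof (rule relative_entropy_projection_le[OF _ s])
    show "0 < F $ i" for i by (simp add: F)
    show "0 \<le> u $ i" "u $ i \<le> 1 / s" for i
      using cS s(1) by (auto simp: u_def intro!: divide_left_mono)
    show "(\<Sum>i\<in>UNIV. u $ i) = 1" using S by (simp add: u_def sum.If_cases)
  qed
  ultimately have "T * (\<eta> * (1 / 2 - \<alpha> / (6 * \<rho>)) - \<eta>\<^sup>2 / 2) < G" using potential by linarith
  then have "T * \<eta> * (\<alpha> / (3 * \<rho>)) < T * \<eta> * (3 / 2 * \<eta>)"
    by (simp add: G_def power2_eq_square field_simps)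
  moreover have "0 < T * \<eta>" using pos by simp
  ultimately have "\<alpha> / (3 * \<rho>) < 3 / 2 * \<eta>" by (simp only: mult_less_cancel_left_pos)
  also have "\<dots> \<le> 3 / 2 * (\<alpha> / (6 * \<rho>))" using \<eta>(2) by simp
  finally show False using pos by (simp add: field_simps)
qed

theorem lemmaB5:
  fixes jprod :: "'a::euclidean_space \<Rightarrow> 'a \<Rightarrow> 'a"
    and e c :: 'a
    and opt \<rho> \<alpha> \<beta> :: real
    and K :: "'a set"
    and a :: "'a ^ 'm::finite"
    and b :: "real ^ 'm"
    and s T :: nat
    and orac :: "real ^ 'm \<Rightarrow> 'a measure"
  assumes "euclidean_jordan_algebra jprod e"
    and "K = program_domain jprod c opt"
    and "width_bound K a b \<rho>"
    and "2 \<le> CARD('m)"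
    and "0 < \<alpha>" and "\<alpha> \<le> 9 * \<rho>"
    and "0 < \<beta>" and "\<beta> < 1"
    and "T = nat \<lceil>36 * \<rho>\<^sup>2 / \<alpha>\<^sup>2 * ln (real CARD('m))\<rceil>"
    and "feasible K a b"
    and "1 \<le> s" and "s \<le> CARD('m)"
    and "approx_oracle K a b \<rho> (\<alpha> / 3) (\<beta> / real T) orac"
  shows "\<P>(x in dense_mw orac a b \<rho> s T.
            x \<in> K \<and> card {i. a $ i \<bullet> x > b $ i + \<alpha>} < s) \<ge> 1 - \<beta>"
proof -
  interpret euclidean_jordan_algebra jprod e by (rule assms(1))
  note K = assms(2) and width = assms(3) and s = assms(11,12)
  define m where "m = real CARD('m)"
  define \<eta> where "\<eta> = sqrt (ln m / real T)"
  have lnm: "0 < ln m" using assms(4) by (simp add: m_def)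
  have \<rho>: "0 < \<rho>" using assms(5,6) by linarith
  have T36: "36 * \<rho>\<^sup>2 / \<alpha>\<^sup>2 * ln m \<le> real T"
    unfolding assms(9) m_def[symmetric] by (rule real_nat_ceiling_ge)
  have "0 < 36 * \<rho>\<^sup>2 / \<alpha>\<^sup>2 * ln m" using lnm \<rho> assms(5) by simp
  then have T: "0 < real T" using T36 by linarith
  have T_ge: "36 * \<rho>\<^sup>2 * ln m \<le> real T * \<alpha>\<^sup>2"
    using T36 assms(5) by (simp add: divide_le_eq)
  have \<eta>0: "0 < \<eta>" and \<eta>2: "real T * \<eta>\<^sup>2 = ln m"
    using lnm T by (simp_all add: \<eta>_def)
  have "ln m / real T \<le> (\<alpha> / (6 * \<rho>))\<^sup>2"
    using T T_ge \<rho> by (simp add: power_divide power_mult_distrib field_simps)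
  then have \<eta>_le: "\<eta> \<le> \<alpha> / (6 * \<rho>)"
    unfolding \<eta>_def using \<rho> assms(5) by (intro real_le_lsqrt) auto

  obtain x\<^sub>0 where x0: "x\<^sub>0 \<in> K" "\<And>i. a $ i \<bullet> x\<^sub>0 \<le> b $ i"
    using assms(10) by (auto simp: feasible_def)
  have orac: "orac \<in> restrict_space borel {y. distribution y} \<rightarrow>\<^sub>M prob_algebra borel"
    using assms(13) by (simp add: approx_oracle_def)
  have K_iff: "x \<in> K \<longleftrightarrow> x \<in> symmetric_cone jprod \<and> c \<bullet> x = opt" for x
    by (simp add: K program_domain_def)
  have "closed K"
    unfolding K program_domain_def
    by (intro closed_Int closed_symmetric_cone closed_hyperplane)
  then have K_borel [measurable]: "K \<in> sets borel" by simp

  define good where "good y = {x. x \<in> K \<and>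
      (\<Sum>i\<in>UNIV. y $ i *\<^sub>R a $ i) \<bullet> x \<le> (INF z\<in>K. (\<Sum>i\<in>UNIV. y $ i *\<^sub>R a $ i) \<bullet> z) + \<alpha> / 3 \<and>
      (\<forall>i. \<bar>a $ i \<bullet> x - b $ i\<bar> \<le> \<rho>)}" for y
  have good_borel: "good y \<in> sets borel" for y
  proof -
    have "good y = {x \<in> space borel. x \<in> K \<and>
      (\<Sum>i\<in>UNIV. y $ i *\<^sub>R a $ i) \<bullet> x \<le> (INF z\<in>K. (\<Sum>i\<in>UNIV. y $ i *\<^sub>R a $ i) \<bullet> z) + \<alpha> / 3 \<and>
      (\<forall>i. \<bar>a $ i \<bullet> x - b $ i\<bar> \<le> \<rho>)}" by (simp add: good_def)
    also have "\<dots> \<in> sets borel" by measurable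
    finally show ?thesis .
  qed
  have good_prob: "1 - \<beta> / real T \<le> measure (orac y) (good y)" if "distribution y" for y
  proof -
    have "orac y \<in> space (prob_algebra borel)"
      using measurable_space[OF orac, of y] that by (simp add: space_restrict_space)
    then have "space (orac y) = UNIV"
      using sets_eq_imp_space_eq[of "orac y" borel] by (simp add: space_prob_algebra)
    moreover have "1 - \<beta> / real T \<le> \<P>(x in orac y. x \<in> good y)"
      using assms(13) that unfolding approx_oracle_def good_def mem_Collect_eq by blast
    ultimately show ?thesis by simp
  qed

  define E where "E = {x. x \<in> K \<and> card {i. a $ i \<bullet> x > b $ i + \<alpha>} < s}"
  have E_borel: "E \<in> sets borel"
  proof -
    have "card {i. a $ i \<bullet> x > b $ i + \<alpha>} < s \<longleftrightarrow>
        (\<Sum>i\<in>UNIV. if a $ i \<bullet> x > b $ i + \<alpha> then 1 else 0) < real s" for x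
      by (simp add: sum.If_cases)
    then have "E = {x \<in> space borel. x \<in> K \<and>
        (\<Sum>i\<in>UNIV. if a $ i \<bullet> x > b $ i + \<alpha> then 1 else 0) < real s}"
      by (simp add: E_def)
    also have "\<dots> \<in> sets borel" by measurable
    finally show ?thesis .
  qed

  \<comment> \<open>The measure \<open>F\<close> is a function of the round number and the sum \<open>X\<close> of the answers, so the state
    carries all the information about the past that the final bound needs. The cone and the
    hyperplane are tracked for the sum, since membership in \<open>K\<close> is meaningful only after averaging.\<close>
  define \<gamma> where "\<gamma> = \<eta> * (1 / 2 - \<alpha> / (6 * \<rho>)) - \<eta>\<^sup>2 / 2"
  define I where "I n F X \<longleftrightarrow> n \<le> T \<and>
      (\<forall>i. F $ i = exp (- (ln m + \<eta> * (real (T - n) * (b $ i / (2 * \<rho>) + 1 / 2) - (a $ i \<bullet> X) / (2 * \<rho>))))) \<and>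
      X \<in> symmetric_cone jprod \<and> c \<bullet> X = real (T - n) * opt \<and>
      real (T - n) * \<gamma> \<le> relative_entropy (bregman_projection s F) F"
    for n X and F :: "real ^ 'm"
  have I_pos: "0 < F $ i" if "I n F X" for n F X i
    using that by (simp add: I_def)
  have I_step: "I n (\<chi> i. exp (- \<eta> * loss a b \<rho> x $ i) * F $ i) (X + x)"
    if I: "I (Suc n) F X" and x: "x \<in> good (bregman_projection s F)" for n F X x
  proof -
    define F' where "F' = (\<chi> i. exp (- \<eta> * loss a b \<rho> x $ i) * F $ i)"
    have n: "real (T - n) = real (T - Suc n) + 1" and nT: "n \<le> T" using I by (auto simp: I_def)
    have F: "0 < F $ i" for i using I by (rule I_pos)
    have l: "0 \<le> loss a b \<rho> x $ i" "loss a b \<rho> x $ i \<le> 1" for i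
      using x \<rho> by (auto simp: good_def intro!: loss_bounds)
    have xK: "x \<in> symmetric_cone jprod" "c \<bullet> x = opt" using x by (auto simp: good_def K_iff)
    have "1 / 2 - \<alpha> / 3 / (2 * \<rho>) \<le> (\<Sum>i\<in>UNIV. bregman_projection s F $ i * loss a b \<rho> x $ i)"
      using x distribution_bregman_projection[OF F s]
      by (intro oracle_answer_loss[OF width \<rho> x0]) (auto simp: good_def)
    then have "\<eta> * (1 / 2 - \<alpha> / (6 * \<rho>)) \<le> \<eta> * (\<Sum>i\<in>UNIV. bregman_projection s F $ i * loss a b \<rho> x $ i)"
      using \<eta>0 by (intro mult_left_mono) auto
    moreover have "relative_entropy (bregman_projection s F) F
        + \<eta> * (\<Sum>i\<in>UNIV. bregman_projection s F $ i * loss a b \<rho> x $ i) - \<eta>\<^sup>2 / 2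
      \<le> relative_entropy (bregman_projection s F') F'"
      unfolding F'_def using \<eta>0 by (intro potential_step[OF F s l]) simp
    moreover have "real (T - Suc n) * \<gamma>
      \<le> relative_entropy (bregman_projection s F) F"
      using I unfolding I_def by blast
    ultimately have "real (T - n) * \<gamma>
      \<le> relative_entropy (bregman_projection s F') F'"
      unfolding n distrib_right mult_1_left \<gamma>_def[symmetric] using \<gamma>_def by linarith
    moreover have "F' $ i = exp (- (ln m + \<eta> * (real (T - n) * (b $ i / (2 * \<rho>) + 1 / 2) - (a $ i \<bullet> (X + x)) / (2 * \<rho>))))" for i
    proof -
      have "F' $ i = exp (- \<eta> * loss a b \<rho> x $ i
          + - (ln m + \<eta> * (real (T - Suc n) * (b $ i / (2 * \<rho>) + 1 / 2) - (a $ i \<bullet> X) / (2 * \<rho>))))"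
        using I unfolding exp_add by (simp add: F'_def I_def)
      also have "- \<eta> * loss a b \<rho> x $ i
          + - (ln m + \<eta> * (real (T - Suc n) * (b $ i / (2 * \<rho>) + 1 / 2) - (a $ i \<bullet> X) / (2 * \<rho>)))
        = - (ln m + \<eta> * (real (T - n) * (b $ i / (2 * \<rho>) + 1 / 2) - (a $ i \<bullet> (X + x)) / (2 * \<rho>)))"
        unfolding n by (simp add: loss_def inner_add_right diff_divide_distrib add_divide_distrib algebra_simps)
      finally show ?thesis .
    qed
    moreover have "X + x \<in> symmetric_cone jprod" "c \<bullet> (X + x) = real (T - n) * opt"
      using I xK by (auto simp: I_def inner_add_right algebra_simps intro: symmetric_cone_add)
    ultimately show ?thesis using nT by (simp add: I_def F'_def)
  qed

  define E\<^sub>T where "E\<^sub>T = (\<lambda>X. (1 / real T) *\<^sub>R X) -` E"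
  have scale [measurable]: "(\<lambda>X :: 'a. (1 / real T) *\<^sub>R X) \<in> borel_measurable borel" by measurable
  then have ET_borel: "E\<^sub>T \<in> sets borel"
    using measurable_sets[OF scale E_borel] by (simp add: E\<^sub>T_def)
  have I_final: "X \<in> E\<^sub>T" if I: "I 0 F X" for F X
  proof -
    have "(1 / real T) *\<^sub>R X \<in> K"
      using I T by (simp add: I_def K_iff symmetric_cone_scaleR)
    moreover have "card {i. a $ i \<bullet> ((1 / real T) *\<^sub>R X) > b $ i + \<alpha>} < s"
      using I by (intro few_violated_constraints[OF s \<rho> assms(5) \<eta>0 T _ \<eta>_le])
        (auto simp: I_def m_def \<gamma>_def \<eta>2[unfolded m_def])
    ultimately show ?thesis by (simp add: E\<^sub>T_def E_def)
  qed
  define F\<^sub>1 :: "real ^ 'm" where "F\<^sub>1 = (\<chi> i. 1 / m)"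
  have m: "0 < m" by (simp add: m_def)
  then have F1: "0 < F\<^sub>1 $ i" for i by (simp add: F\<^sub>1_def)
  have "I T F\<^sub>1 0"
  proof -
    have "0 \<le> relative_entropy (bregman_projection s F\<^sub>1) F\<^sub>1"
      using relative_entropy_ge[of "bregman_projection s F\<^sub>1" F\<^sub>1] F1 bregman_projection_pos[OF F1 s]
      by (simp add: sum_bregman_projection[OF F1 s] less_imp_le) (simp add: F\<^sub>1_def m_def)
    moreover have "F\<^sub>1 $ i = exp (- ln m)" for i using m by (simp add: F\<^sub>1_def exp_minus inverse_eq_divide)
    ultimately show ?thesis by (simp add: I_def zero_in_symmetric_cone)
  qed
  define R where "R = dense_mw_rounds orac a b \<rho> s \<eta> T F\<^sub>1 0"
  have bound: "1 - real T * (\<beta> / real T) \<le> measure R E\<^sub>T"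
    unfolding R_def using \<open>I T F\<^sub>1 0\<close> assms(7)
    by (intro dense_mw_rounds_invariant[where good = good and I = I, OF orac s good_borel good_prob _ ET_borel I_pos I_step I_final]) auto
  have R: "R \<in> space (prob_algebra borel)"
    unfolding R_def by (rule dense_mw_rounds_in_prob_algebra[OF orac s F1])
  then have Rsets [measurable_cong]: "sets R = sets borel" and "prob_space R"
    by (auto simp: space_prob_algebra)
  then interpret R: prob_space R by simp
  have Rspace: "space R = UNIV" using sets_eq_imp_space_eq[OF Rsets] by simp
  have "dense_mw orac a b \<rho> s T = R \<bind> (\<lambda>X. return borel ((1 / real T) *\<^sub>R X))"
    by (simp add: dense_mw_def R_def \<eta>_def F\<^sub>1_def m_def)
  also have "\<dots> = distr R borel (\<lambda>X. (1 / real T) *\<^sub>R X)"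
    using scale by (intro bind_return_distr') (auto simp: Rspace cong: measurable_cong_sets)
  finally have D: "dense_mw orac a b \<rho> s T = distr R borel (\<lambda>X. (1 / real T) *\<^sub>R X)" .
  have "measure (dense_mw orac a b \<rho> s T) E = measure R E\<^sub>T"
    unfolding D by (subst measure_distr) (auto simp: E_borel Rspace E\<^sub>T_def)
  then show ?thesis using bound T by (simp add: D E_def)
qed

end
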